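(* Fix $(\vartheta,\kappa)\in(0,1)^2$, $r>0$, $a\ge 1$ with $\kappa>1-\vartheta$, an integer $m_0\ge 1$ and a constant $c_0>0$, and let $g=g(m_0,\vartheta,r)$. Consider the linear model $Y=X\beta+\sigma z$ in which $\beta$ follows ARW$(\vartheta,r,a,\mu)$ and $X$ follows RD$(\vartheta,\kappa,\Omega)$, where $\Omega\in\mathcal M_p(c_0,g)$ for all sufficiently large $p$. Then, as $p\to\infty$, $$\mathrm{Hamm}_p^*(\vartheta,\kappa,r,a,\Omega)\ \ge\ L_p\,\big[d_p(\mathcal G^{\diamond})\big]^{-1}\sum_{j=1}^p p^{-\rho_j^*(\vartheta,r,a,\Omega)}.$$
   Context: Setting: $p\to\infty$ is the asymptotic parameter and all objects may depend on $p$. One observes $Y=X\beta+\sigma z\in\mathbb R^n$, where $X$ is $n\times p$, $z\sim N(0,I_n)$ and $\sigma>0$ is known. Random design model RD$(\vartheta,\kappa,\Omega)$: $n=n_p=p^{\kappa}$ and the rows of $X$ are i.i.d. $N(0,\frac1n\Omega)$, where $\Omega$ is a $p\times p$ correlation matrix (positive definite, unit diagonal). Asymptotic Rare and Weak model ARW$(\vartheta,r,a,\mu)$: $\epsilon_p=p^{-\vartheta}$, $\tau_p=\sigma\sqrt{2r\log p}$, $b=(b_1,\dots,b_p)'$ has i.i.d. Bernoulli$(\epsilon_p)$ entries independent of $(X,z)$, and $\beta=b\circ\mu$ (entrywise product), with $\mu\in\Theta_p^*(\tau_p,a):=\{\mu\in\mathbb R^p:\ \tau_p\le|\mu_i|\le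 a\tau_p\ \forall i\}$. Hamming risk of an estimator $\hat\beta$: $H_p(\hat\beta;\epsilon_p,n_p,\mu,\Omega)=\mathbb E\big[\sum_{j=1}^p 1\{\mathrm{sgn}(\hat\beta_j)\ne\mathrm{sgn}(\beta_j)\}\big]$, the expectation being over $b$, $X$ and $z$. Minimax Hamming distance: $\mathrm{Hamm}_p^*(\vartheta,\kappa,r,a,\Omega)=\inf_{\hat\beta}\sup_{\mu\in\Theta_p^*(\tau_p,a)}H_p(\hat\beta;\epsilon_p,n_p,\mu,\Omega)$. $L_p$ denotes a positive multi-$\log(p)$ factor: $L_p p^{\delta}\to\infty$ and $L_pp^{-\delta}\to0$ as $p\to\infty$ for every fixed $\delta>0$. $\lambda_k^*(\Omega)$ is the minimum, over all $k\times k$ principal submatrices of $\Omega$, of their smallest eigenvalue. $g=g(m_0,\vartheta,r)$ is the smallest integer with $g\ge\max\{m_0,(\vartheta+r)^2/(2\vartheta r)\}$, and $\mathcal M_p(c_0,g)$ is the set of $p\times p$ correlation matrices $\Omega$ with $\lambda_g^*(\Omega)\ge c_0$. Exponents: for $V\subset\{1,\dots,p\}$ let $I_V\in\{0,1\}^p$ be its indicator vector and $B_V=\{I_V\circ\mu:\ \mu\in\Theta_p^*(\tau_p,a)\}$. Let $\alpha(\theta^{(0)},\theta^{(1)})=\tau_p^{-2}(\theta^{(0)}-\theta^{(1)})'\Omega(\theta^{(0)}-\theta^{(1)})$. For $V_0,V_1\subset\{1,\dots,p\}$ let $\alpha^*(V_0,V_1)=\min\{\alpha(\theta^{(0)},\theta^{(1)}):\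 \theta^{(i)}\in B_{V_i},\ i=0,1,\ \mathrm{sgn}(\theta^{(0)})\ne\mathrm{sgn}(\theta^{(1)})\}$, $$\eta(V_0,V_1)=\max\{|V_0|,|V_1|\}\vartheta+\frac14\Big[\Big(\sqrt{\alpha^*(V_0,V_1)r}-\frac{\big||V_1|-|V_0|\big|\vartheta}{\sqrt{\alpha^*(V_0,V_1)r}}\Big)_+\Big]^2,$$ with $x_+=\max\{x,0\}$, and $\rho_j^*(\vartheta,r,a,\Omega)=\min\{\eta(V_0,V_1):\ j\in V_0\cup V_1\}$. Graph of Least Favorables (GOLF) $\mathcal G^\diamond$: for each $j$ let $(V_{0j}^*,V_{1j}^* )$ be the minimizing pair in the definition of $\rho_j^*$ (ties broken by taking the lexicographically first pair); $\mathcal G^\diamond$ has vertex set $\{1,\dots,p\}$ and an edge between $j$ and $k$ iff $(V_{0j}^*\cup V_{1j}^* )\cap(V_{0k}^*\cup V_{1k}^* )\ne\emptyset$; $d_p(\mathcal G^\diamond)$ is its maximum degree.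
   Formalization: The factor [d_p]^{-1} is read as 1/max{1, d_p}: the maximum degree of the graph of least favorables can be 0 (for instance when Ω is the identity), and then the inverse is undefined; for d_p ≥ 1 nothing changes. *)

theory Defs
  imports "HOL-Probability.Probability" "HOL-Library.List_Lexorder"
begin

(* Vectors in R^p are functions nat => real, indices 0..p-1 (i < p);
   p x p matrices are functions nat => nat => real, entries i,j < p. *)

definition n_of :: "real \<Rightarrow> nat \<Rightarrow> nat" where
  "n_of \<kappa> p = nat \<lceil>real p powr \<kappa>\<rceil>"

definition eps_of :: "real \<Rightarrow> nat \<Rightarrow> real" where
  "eps_of \<theta> p = real p powr (- \<theta>)"

definition tau_of :: "real \<Rightarrow> real \<Rightarrow> nat \<Rightarrow> real" where
  "tau_of \<sigma> r p = \<sigma> * sqrt (2 * r * ln (real p))"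

definition quad :: "nat \<Rightarrow> (nat \<Rightarrow> nat \<Rightarrow> real) \<Rightarrow> (nat \<Rightarrow> real) \<Rightarrow> real" where
  "quad p \<Omega> x = (\<Sum>i<p. \<Sum>j<p. x i * \<Omega> i j * x j)"

definition corr_matrix :: "nat \<Rightarrow> (nat \<Rightarrow> nat \<Rightarrow> real) \<Rightarrow> bool" where
  "corr_matrix p \<Omega> \<longleftrightarrow>
     (\<forall>i<p. \<Omega> i i = 1) \<and> (\<forall>i<p. \<forall>j<p. \<Omega> i j = \<Omega> j i) \<and>
     (\<forall>x. (\<exists>i<p. x i \<noteq> 0) \<longrightarrow> quad p \<Omega> x > 0)"

(* lambda_g^*(Omega) >= c0: every eigenvalue of every g x g principal submatrix
   (i.e. the smallest one) is >= c0 *)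
definition in_M :: "nat \<Rightarrow> real \<Rightarrow> nat \<Rightarrow> (nat \<Rightarrow> nat \<Rightarrow> real) \<Rightarrow> bool" where
  "in_M p c0 g \<Omega> \<longleftrightarrow> corr_matrix p \<Omega> \<and>
     (\<forall>S. S \<subseteq> {..<p} \<longrightarrow> card S = g \<longrightarrow>
        (\<forall>lam v. (\<exists>i\<in>S. v i \<noteq> 0) \<and> (\<forall>i\<in>S. (\<Sum>k\<in>S. \<Omega> i k * v k) = lam * v i)
                \<longrightarrow> c0 \<le> lam))"

definition g_of :: "nat \<Rightarrow> real \<Rightarrow> real \<Rightarrow> nat" where
  "g_of m0 \<theta> r = nat \<lceil>max (real m0) ((\<theta> + r)\<^sup>2 / (2 * \<theta> * r))\<rceil>"

definition Theta :: "nat \<Rightarrow> real \<Rightarrow> real \<Rightarrow> (nat \<Rightarrow> real) set" where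
  "Theta p \<tau> a = {\<mu>. (\<forall>i<p. \<tau> \<le> \<bar>\<mu> i\<bar> \<and> \<bar>\<mu> i\<bar> \<le> a * \<tau>) \<and> (\<forall>i\<ge>p. \<mu> i = 0)}"

(* a square root L of Omega: L L' = Omega; used to realise N(0, Omega/n) rows *)
definition sqrtm :: "nat \<Rightarrow> (nat \<Rightarrow> nat \<Rightarrow> real) \<Rightarrow> (nat \<Rightarrow> nat \<Rightarrow> real)" where
  "sqrtm p \<Omega> = (SOME L. \<forall>i<p. \<forall>j<p. (\<Sum>k<p. L i k * L j k) = \<Omega> i j)"

definition std_normal_measure :: "real measure" where
  "std_normal_measure = density lborel std_normal_density"

definition sample_space :: "real \<Rightarrow> nat \<Rightarrow> nat \<Rightarrow>
    ((nat \<Rightarrow> bool) \<times> ((nat \<times> nat \<Rightarrow> real) \<times> (nat \<Rightarrow> real))) measure" where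
  "sample_space \<epsilon> n p =
     PiM {..<p} (\<lambda>_. measure_pmf (bernoulli_pmf \<epsilon>)) \<Otimes>\<^sub>M
     (PiM ({..<n} \<times> {..<p}) (\<lambda>_. std_normal_measure) \<Otimes>\<^sub>M PiM {..<n} (\<lambda>_. std_normal_measure))"

definition data_space :: "nat \<Rightarrow> nat \<Rightarrow> ((nat \<times> nat \<Rightarrow> real) \<times> (nat \<Rightarrow> real)) measure" where
  "data_space n p = PiM ({..<n} \<times> {..<p}) (\<lambda>_. borel) \<Otimes>\<^sub>M PiM {..<n} (\<lambda>_. borel)"

(* design matrix X = W L' / sqrt n : rows iid N(0, Omega/n) *)
definition design :: "nat \<Rightarrow> nat \<Rightarrow> (nat \<Rightarrow> nat \<Rightarrow> real) \<Rightarrow> (nat \<times> nat \<Rightarrow> real) \<Rightarrow> (nat \<times> nat \<Rightarrow> real)" where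
  "design n p \<Omega> W = restrict (\<lambda>(i, j). (1 / sqrt (real n)) * (\<Sum>k<p. W (i, k) * sqrtm p \<Omega> j k))
                        ({..<n} \<times> {..<p})"

definition beta_of :: "(nat \<Rightarrow> bool) \<Rightarrow> (nat \<Rightarrow> real) \<Rightarrow> nat \<Rightarrow> real" where
  "beta_of b \<mu> = (\<lambda>j. if b j then \<mu> j else 0)"

definition response :: "nat \<Rightarrow> nat \<Rightarrow> real \<Rightarrow> (nat \<times> nat \<Rightarrow> real) \<Rightarrow> (nat \<Rightarrow> real) \<Rightarrow> (nat \<Rightarrow> real)
    \<Rightarrow> (nat \<Rightarrow> real)" where
  "response n p \<sigma> X \<beta> z = restrict (\<lambda>i. (\<Sum>j<p. X (i, j) * \<beta> j) + \<sigma> * z i) {..<n}"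

definition estimators :: "nat \<Rightarrow> nat \<Rightarrow> (((nat \<times> nat \<Rightarrow> real) \<times> (nat \<Rightarrow> real)) \<Rightarrow> nat \<Rightarrow> real) set" where
  "estimators n p = {est. \<forall>j<p. (\<lambda>d. est d j) \<in> borel_measurable (data_space n p)}"

definition hamming_loss :: "nat \<Rightarrow> (nat \<Rightarrow> real) \<Rightarrow> (nat \<Rightarrow> real) \<Rightarrow> real" where
  "hamming_loss p \<beta>hat \<beta> = (\<Sum>j<p. if sgn (\<beta>hat j) \<noteq> sgn (\<beta> j) then 1 else 0)"

definition hamming_risk ::
  "real \<Rightarrow> nat \<Rightarrow> nat \<Rightarrow> real \<Rightarrow> (nat \<Rightarrow> nat \<Rightarrow> real)
   \<Rightarrow> (((nat \<times> nat \<Rightarrow> real) \<times> (nat \<Rightarrow> real)) \<Rightarrow> nat \<Rightarrow> real) \<Rightarrow> (nat \<Rightarrow> real) \<Rightarrow> real" where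
  "hamming_risk \<epsilon> n p \<sigma> \<Omega> est \<mu> =
     integral\<^sup>L (sample_space \<epsilon> n p)
       (\<lambda>(b, W, z). let X = design n p \<Omega> W; \<beta> = beta_of b \<mu> in
          hamming_loss p (est (X, response n p \<sigma> X \<beta> z)) \<beta>)"

definition Hamm_star :: "real \<Rightarrow> real \<Rightarrow> real \<Rightarrow> real \<Rightarrow> real \<Rightarrow> nat \<Rightarrow> (nat \<Rightarrow> nat \<Rightarrow> real) \<Rightarrow> real" where
  "Hamm_star \<sigma> \<theta> \<kappa> r a p \<Omega> =
     (INF est \<in> estimators (n_of \<kappa> p) p.
        SUP \<mu> \<in> Theta p (tau_of \<sigma> r p) a.
          hamming_risk (eps_of \<theta> p) (n_of \<kappa> p) p \<sigma> \<Omega> est \<mu>)"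

definition B_set :: "nat \<Rightarrow> real \<Rightarrow> real \<Rightarrow> nat set \<Rightarrow> (nat \<Rightarrow> real) set" where
  "B_set p \<tau> a V = {\<theta>. \<exists>\<mu>\<in>Theta p \<tau> a. \<theta> = (\<lambda>i. if i \<in> V then \<mu> i else 0)}"

definition alpha_star :: "nat \<Rightarrow> real \<Rightarrow> real \<Rightarrow> (nat \<Rightarrow> nat \<Rightarrow> real) \<Rightarrow> nat set \<Rightarrow> nat set \<Rightarrow> real" where
  "alpha_star p \<tau> a \<Omega> V0 V1 =
     Inf {quad p \<Omega> (\<lambda>i. \<theta>0 i - \<theta>1 i) / \<tau>\<^sup>2 | \<theta>0 \<theta>1.
            \<theta>0 \<in> B_set p \<tau> a V0 \<and> \<theta>1 \<in> B_set p \<tau> a V1 \<and> (\<lambda>i. sgn (\<theta>0 i)) \<noteq> (\<lambda>i. sgn (\<theta>1 i))}"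

definition eta :: "nat \<Rightarrow> real \<Rightarrow> real \<Rightarrow> real \<Rightarrow> real \<Rightarrow> (nat \<Rightarrow> nat \<Rightarrow> real) \<Rightarrow> nat set \<Rightarrow> nat set \<Rightarrow> real" where
  "eta p \<theta> r \<tau> a \<Omega> V0 V1 =
     (let \<alpha> = alpha_star p \<tau> a \<Omega> V0 V1 in
      real (max (card V0) (card V1)) * \<theta> +
      (1/4) * (max 0 (sqrt (\<alpha> * r) - \<bar>real (card V1) - real (card V0)\<bar> * \<theta> / sqrt (\<alpha> * r)))\<^sup>2)"

definition pairs_for :: "nat \<Rightarrow> nat \<Rightarrow> (nat set \<times> nat set) set" where
  "pairs_for p j = {(V0, V1). V0 \<subseteq> {..<p} \<and> V1 \<subseteq> {..<p} \<and> j \<in> V0 \<union> V1}"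

definition rho_star :: "real \<Rightarrow> real \<Rightarrow> real \<Rightarrow> real \<Rightarrow> nat \<Rightarrow> (nat \<Rightarrow> nat \<Rightarrow> real) \<Rightarrow> nat \<Rightarrow> real" where
  "rho_star \<sigma> \<theta> r a p \<Omega> j =
     Min ((\<lambda>(V0, V1). eta p \<theta> r (tau_of \<sigma> r p) a \<Omega> V0 V1) ` pairs_for p j)"

(* minimising pair, ties broken by taking the lexicographically first pair:
   pairs compared lexicographically (first component first), sets compared via the
   lexicographic order on their sorted element lists *)
definition golf_pair :: "real \<Rightarrow> real \<Rightarrow> real \<Rightarrow> real \<Rightarrow> nat \<Rightarrow> (nat \<Rightarrow> nat \<Rightarrow> real) \<Rightarrow> nat \<Rightarrow> nat set \<times> nat set" where
  "golf_pair \<sigma> \<theta> r a p \<Omega> j =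
     (let Mins = {(V0, V1) \<in> pairs_for p j.
                    eta p \<theta> r (tau_of \<sigma> r p) a \<Omega> V0 V1 = rho_star \<sigma> \<theta> r a p \<Omega> j};
          l0 = Min ((\<lambda>(V0, V1). sorted_list_of_set V0) ` Mins);
          l1 = Min ((\<lambda>(V0, V1). sorted_list_of_set V1) ` {(V0, V1) \<in> Mins. sorted_list_of_set V0 = l0})
      in (set l0, set l1))"

definition golf_support :: "real \<Rightarrow> real \<Rightarrow> real \<Rightarrow> real \<Rightarrow> nat \<Rightarrow> (nat \<Rightarrow> nat \<Rightarrow> real) \<Rightarrow> nat \<Rightarrow> nat set" where
  "golf_support \<sigma> \<theta> r a p \<Omega> j = fst (golf_pair \<sigma> \<theta> r a p \<Omega> j) \<union> snd (golf_pair \<sigma> \<theta> r a p \<Omega> j)"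

definition golf_degree :: "real \<Rightarrow> real \<Rightarrow> real \<Rightarrow> real \<Rightarrow> nat \<Rightarrow> (nat \<Rightarrow> nat \<Rightarrow> real) \<Rightarrow> nat" where
  "golf_degree \<sigma> \<theta> r a p \<Omega> =
     Max ((\<lambda>j. card {k. k < p \<and> k \<noteq> j \<and>
                golf_support \<sigma> \<theta> r a p \<Omega> j \<inter> golf_support \<sigma> \<theta> r a p \<Omega> k \<noteq> {}}) ` {..<p})"

definition multi_log :: "(nat \<Rightarrow> real) \<Rightarrow> bool" where
  "multi_log L \<longleftrightarrow> (\<forall>p. L p > 0) \<and>
     (\<forall>\<delta>>0. filterlim (\<lambda>p. L p * real p powr \<delta>) at_top sequentially \<and>
             (\<lambda>p. L p * real p powr (- \<delta>)) \<longlonglongrightarrow> 0)"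

end

theory Submission
  imports Defs "HOL-Real_Asymp.Real_Asymp"
begin

text \<open>
  A greedy choice of vertices in the graph of least favorables gives a set I of indices with pairwise
  disjoint supports that keeps at least a fraction 1 / (d + 1) of the sum of \<open>p powr - \<rho> j\<close>. The signal
  \<open>\<mu>\<close> gets a prior that on each of these supports chooses independently, with probability 1/2 each,
  one of the two members of a nearly least favorable pair. The minimax risk dominates the Bayes risk, and
  given everything outside one support the Bayes risk dominates that of testing the two members of
  the pair at a coordinate where their signs differ.

  For this test both Gaussian laws are shifted to an intermediate mean. The two likelihood ratios
  there differ from their typical values by at most the factor exp (- |y|) with y Gaussian of variance
  of order log p, so that no sharp tail estimate is needed; the intermediate point that balances the two
  weighted errors yields exactly the exponent \<open>\<eta>\<close>. The random design enters only through the squared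
  length of X applied to the difference, which is at most (1 + \<delta>) times its mean with
  probability at least \<delta> / (1 + \<delta>) by Markov's inequality.

  Since \<open>\<rho> j\<close> is at most (\<theta> + r)^2 / (4 r), the supports have bounded size, so the
  coordinates of b inside a support cost only a constant factor.
\<close>

section \<open>Combinatorial preliminaries\<close>

text \<open>The claim tolerates any loss p^(-\<delta>), and this decides the tools. Three losses are
  accepted for a fixed \<delta>: \<open>alpha_star\<close> is approached up to \<delta> and not
  attained, the random squared separation is allowed to exceed its mean by the factor 1 + \<delta>,
  and a Gaussian of variance of order log p costs exp (- K) with K of order sqrt (log p). Each
  lowers the exponent by a multiple of \<delta>; the remaining constants depend on \<delta> but not
  on p. The tests belonging to different j cannot simply be added up: if two supports overlap, the
  two pairs prescribe conflicting values of the signal. Disjoint supports can be filled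
  independently because \<open>Theta\<close> is a product of coordinate ranges, and restricting to
  them is what costs the degree. The power of p arises as follows. A support of size v has prior
  weight p^(-v \<theta>), and a squared separation \<alpha> \<tau>^2 with \<tau>^2 = 2 r \<sigma>^2
  log p, shifted by the fraction s, has likelihood cost p^(-s^2 \<alpha> r). Equating v0 \<theta> +
  s^2 \<alpha> r with v1 \<theta> + (1 - s)^2 \<alpha> r determines s.\<close>

lemma weighted_independent_set:
  fixes w :: "'a \<Rightarrow> real"
  assumes "finite S" and "symp R"
    and w0: "\<And>x. x \<in> S \<Longrightarrow> 0 \<le> w x"
    and deg: "\<And>x. x \<in> S \<Longrightarrow> card {y \<in> S. y \<noteq> x \<and> R x y} \<le> d"
  shows "\<exists>I\<subseteq>S. (\<forall>x\<in>I. \<forall>y\<in>I. x \<noteq> y \<longrightarrow> \<not> R x y) \<and> sum w S \<le> real (d + 1) * sum w I"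
  using assms(1) w0 deg
proof (induction "card S" arbitrary: S rule: less_induct)
  case less
  show ?case
  proof (cases "S = {}")
    case False
    have "Max (w ` S) \<in> w ` S" using less.prems(1) False by (intro Max_in) auto
    \<comment> \<open>A heaviest vertex: each of its at most \<open>d\<close> neighbours weighs no
      more than \<open>v\<close>, so discarding them loses at most \<open>d\<close> times the weight
      that is kept.\<close>
    then obtain v where "v \<in> S" and "Max (w ` S) = w v" by blast
    hence v: "v \<in> S" "\<And>y. y \<in> S \<Longrightarrow> w y \<le> w v"
      using Max_ge[of "w ` S"] less.prems(1) by auto
    define N where "N = {y \<in> S. y \<noteq> v \<and> R v y}"
    define S' where "S' = S - insert v N"
    have fin: "finite N" "finite S'" using less.prems(1) by (auto simp: N_def S'_def)
    have "card S' < card S" unfolding S'_def using v(1) less.prems(1)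
      by (intro psubset_card_mono) auto
    moreover have "card {y \<in> S'. y \<noteq> x \<and> R x y} \<le> d" if "x \<in> S'" for x
    proof -
      have "card {y \<in> S'. y \<noteq> x \<and> R x y} \<le> card {y \<in> S. y \<noteq> x \<and> R x y}"
        using less.prems(1) by (intro card_mono) (auto simp: S'_def)
      also have "\<dots> \<le> d" using that less.prems(3) by (auto simp: S'_def)
      finally show ?thesis .
    qed
    moreover have "0 \<le> w x" if "x \<in> S'" for x using that less.prems(2) by (simp add: S'_def)
    ultimately obtain I where I: "I \<subseteq> S'" "\<forall>x\<in>I. \<forall>y\<in>I. x \<noteq> y \<longrightarrow> \<not> R x y"
      "sum w S' \<le> real (d + 1) * sum w I"
      using less.hyps[of S'] fin(2) by blast
    have vN: "v \<notin> N" by (simp add: N_def)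
    have "sum w (insert v N) \<le> (\<Sum>y\<in>insert v N. w v)"
      by (intro sum_mono v(2)) (use v(1) in \<open>auto simp: N_def\<close>)
    also have "\<dots> = real (card N + 1) * w v" using fin(1) vN by (simp add: algebra_simps)
    also have "\<dots> \<le> real (d + 1) * w v"
      using less.prems(2,3)[OF v(1)] by (intro mult_right_mono) (auto simp: N_def)
    finally have 1: "sum w (insert v N) \<le> real (d + 1) * w v" .
    have "sum w S = sum w S' + sum w (insert v N)"
      unfolding S'_def using v(1) less.prems(1)
      by (intro sum.subset_diff) (auto simp: N_def)
    also have "\<dots> \<le> real (d + 1) * sum w I + real (d + 1) * w v" using 1 I(3) by simp
    also have "\<dots> = real (d + 1) * sum w (insert v I)"
      using I(1) fin(2) by (subst sum.insert) (auto simp: S'_def algebra_simps intro: finite_subset)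
    finally have "sum w S \<le> real (d + 1) * sum w (insert v I)" .
    moreover have "\<forall>x\<in>insert v I. \<forall>y\<in>insert v I. x \<noteq> y \<longrightarrow> \<not> R x y"
      using I(1,2) \<open>symp R\<close> by (auto simp: S'_def N_def dest: sympD)
    moreover have "insert v I \<subseteq> S" using I(1) v(1) by (auto simp: S'_def)
    ultimately show ?thesis by blast
  qed auto
qed

text \<open>\<open>sqrtm\<close> is a choice term, so the law of the design is known only once some
  root exists. Cholesky elimination supplies one, a coordinate per induction step; \<open>Q\<close>
  is generalised because the induction hypothesis is applied to a Schur complement.\<close>

lemma pos_def_factorization:
  fixes Q :: "'a \<Rightarrow> 'a \<Rightarrow> real"
  assumes "finite S"
    and "\<And>i j. i \<in> S \<Longrightarrow> j \<in> S \<Longrightarrow> Q i j = Q j i"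
    and "\<And>x. \<exists>i\<in>S. x i \<noteq> 0 \<Longrightarrow> 0 < (\<Sum>i\<in>S. \<Sum>j\<in>S. x i * Q i j * x j)"
  shows "\<exists>L. \<forall>i\<in>S. \<forall>j\<in>S. (\<Sum>k\<in>S. L i k * L j k) = Q i j"
  using assms
proof (induction S arbitrary: Q rule: finite_induct)
  case (insert a S)
  note a = \<open>a \<notin> S\<close>
  have quad_split: "(\<Sum>i\<in>insert a S. \<Sum>j\<in>insert a S. x i * Q i j * x j) =
      x a * Q a a * x a + 2 * x a * (\<Sum>j\<in>S. Q a j * x j) + (\<Sum>i\<in>S. \<Sum>j\<in>S. x i * Q i j * x j)" for x :: "'a \<Rightarrow> real"
  proof -
    have "(\<Sum>i\<in>S. x i * Q i a * x a) = x a * (\<Sum>j\<in>S. Q a j * x j)"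
      unfolding sum_distrib_left
      by (intro sum.cong refl) (metis insert.prems(1) insertI1 insertI2 mult.assoc mult.commute)
    moreover have "(\<Sum>j\<in>S. x a * Q a j * x j) = x a * (\<Sum>j\<in>S. Q a j * x j)"
      by (simp add: sum_distrib_left mult.assoc)
    ultimately show ?thesis using insert.hyps by (simp add: sum.distrib)
  qed
  define e where "e i = (if i = a then 1 else 0 :: real)" for i
  have eS: "e i = 0" if "i \<in> S" for i using that a by (auto simp: e_def)
  have "0 < (\<Sum>i\<in>insert a S. \<Sum>j\<in>insert a S. e i * Q i j * e j)"
    by (rule insert.prems(2)) (auto simp: e_def)
  hence qa: "Q a a > 0" unfolding quad_split by (simp add: eS) (simp add: e_def)
  \<comment> \<open>Schur complement\<close>
  define Q' where "Q' i j = Q i j - Q i a * Q a j / Q a a" for i j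
  have "\<exists>L. \<forall>i\<in>S. \<forall>j\<in>S. (\<Sum>k\<in>S. L i k * L j k) = Q' i j"
  proof (rule insert.IH)
    show "Q' i j = Q' j i" if "i \<in> S" "j \<in> S" for i j
      using that insert.prems(1)[of i j] insert.prems(1)[of i a] insert.prems(1)[of j a]
      by (simp add: Q'_def)
    fix x :: "'a \<Rightarrow> real" assume x: "\<exists>i\<in>S. x i \<noteq> 0"
    define s where "s = (\<Sum>j\<in>S. Q a j * x j)"
    \<comment> \<open>This value of the coordinate \<open>a\<close> minimises the form of
      \<open>Q\<close> in that coordinate. The minimum is the form of \<open>Q'\<close> at
      \<open>x\<close>, so \<open>Q'\<close> inherits positivity.\<close>
    define y where "y = x(a := - s / Q a a)"
    have yS: "y i = x i" if "i \<in> S" for i using that a by (auto simp: y_def)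
    have "0 < (\<Sum>i\<in>insert a S. \<Sum>j\<in>insert a S. y i * Q i j * y j)"
      by (rule insert.prems(2)) (use x yS in auto)
    also have "\<dots> = - s\<^sup>2 / Q a a + (\<Sum>i\<in>S. \<Sum>j\<in>S. x i * Q i j * x j)"
    proof -
      have "(\<Sum>j\<in>S. Q a j * y j) = s" unfolding s_def by (intro sum.cong) (auto simp: yS)
      moreover have "(\<Sum>i\<in>S. \<Sum>j\<in>S. y i * Q i j * y j) = (\<Sum>i\<in>S. \<Sum>j\<in>S. x i * Q i j * x j)"
        by (intro sum.cong) (auto simp: yS)
      moreover have "y a = - s / Q a a" by (simp add: y_def)
      ultimately show ?thesis unfolding quad_split using qa
        by (simp add: power2_eq_square)
    qed
    also have "s\<^sup>2 = (\<Sum>i\<in>S. \<Sum>j\<in>S. x i * (Q i a * Q a j) * x j)"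
      unfolding power2_eq_square s_def sum_product
      by (intro sum.cong refl) (metis insert.prems(1) insertI1 insertI2 mult.assoc mult.commute)
    also have "- (\<Sum>i\<in>S. \<Sum>j\<in>S. x i * (Q i a * Q a j) * x j) / Q a a + (\<Sum>i\<in>S. \<Sum>j\<in>S. x i * Q i j * x j)
       = (\<Sum>i\<in>S. \<Sum>j\<in>S. x i * Q' i j * x j)"
      by (simp add: Q'_def algebra_simps sum_subtractf sum_divide_distrib)
    finally show "0 < (\<Sum>i\<in>S. \<Sum>j\<in>S. x i * Q' i j * x j)" .
  qed
  then obtain L' where L': "\<And>i j. i \<in> S \<Longrightarrow> j \<in> S \<Longrightarrow> (\<Sum>k\<in>S. L' i k * L' j k) = Q' i j"
    by blast
  \<comment> \<open>The new column reproduces row and column \<open>a\<close> of \<open>Q\<close>;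
    its product with itself is exactly the rank-one term that the Schur complement
    subtracts.\<close>
  define L where "L i k = (if k = a then Q i a / sqrt (Q a a) else if i = a then 0 else L' i k)" for i k
  have "(\<Sum>k\<in>insert a S. L i k * L j k) = Q i j" if "i \<in> insert a S" "j \<in> insert a S" for i j
  proof -
    have "(\<Sum>k\<in>S. L i k * L j k) = (if i = a \<or> j = a then 0 else Q' i j)"
    proof (cases "i = a \<or> j = a")
      case True
      hence "L i k * L j k = 0" if "k \<in> S" for k using that a by (auto simp: L_def)
      thus ?thesis using True by (simp add: sum.neutral)
    next
      case False
      hence "(\<Sum>k\<in>S. L i k * L j k) = (\<Sum>k\<in>S. L' i k * L' j k)"
        using a by (intro sum.cong) (auto simp: L_def)
      thus ?thesis using False that L'[of i j] by simp
    qed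
    moreover have "L i a * L j a = Q i a * Q a j / Q a a"
      using qa insert.prems(1)[of j a] that by (simp add: L_def)
    ultimately show ?thesis using insert.hyps qa insert.prems(1)[of i j] by (auto simp: Q'_def)
  qed
  thus ?case by blast
qed auto

section \<open>Sums over supports with Bernoulli weights, and the block prior\<close>

lemma sum_Pow_insert:
  fixes f :: "'a set \<Rightarrow> real"
  assumes "finite I" "j \<in> I"
  shows "(\<Sum>T\<in>Pow I. f T) = (\<Sum>T\<in>Pow (I - {j}). f T + f (insert j T))"
proof -
  have "Pow I = Pow (I - {j}) \<union> insert j ` Pow (I - {j})"
    using assms(2) Pow_insert[of j "I - {j}"] by (simp add: insert_absorb)
  moreover have "inj_on (insert j) (Pow (I - {j}))" by (auto intro!: inj_onI)
  ultimately show ?thesis using assms(1)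
    by (simp add: sum.union_disjoint sum.reindex sum.distrib del: Pow_insert)
      (subst sum.union_disjoint, auto simp: sum.reindex)
qed

lemma sum_Pow_Bernoulli:
  fixes \<epsilon> :: real
  assumes "finite U"
  shows "(\<Sum>B\<in>Pow U. \<epsilon> ^ card B * (1 - \<epsilon>) ^ card (U - B)) = 1"
proof -
  have "(\<Sum>B\<in>Pow U. \<epsilon> ^ card B * (1 - \<epsilon>) ^ card (U - B)) = (\<Prod>x\<in>U. \<epsilon> + (1 - \<epsilon>))"
    by (subst prod_add[OF assms]) (simp only: prod_constant)
  thus ?thesis by simp
qed

text \<open>Only supports that meet \<open>D\<close> in exactly \<open>V\<close> are kept; on
  \<open>D\<close> they have weight
  \<open>\<epsilon> ^ card V * (1 - \<epsilon>) ^ card (D - V)\<close>. Lowering the second factor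
  to \<open>(1 - \<epsilon>) ^ card D\<close> makes it independent of \<open>V\<close>, so that both
  alternatives of a block share it.\<close>

lemma Bernoulli_sum_ge_block:
  fixes \<epsilon> :: real and g :: "'a set \<Rightarrow> real"
  assumes "finite U" "0 \<le> \<epsilon>" "\<epsilon> \<le> 1" "D \<subseteq> U" "V \<subseteq> D" "\<And>B. 0 \<le> g B"
  shows "(\<Sum>B\<in>Pow (U - D). \<epsilon> ^ card B * (1 - \<epsilon>) ^ card (U - D - B) *
            ((1 - \<epsilon>) ^ card D * (\<epsilon> ^ card V * g (B \<union> V))))
         \<le> (\<Sum>B\<in>Pow U. \<epsilon> ^ card B * (1 - \<epsilon>) ^ card (U - B) * g B)"
proof -
  have fD: "finite D" by (rule finite_subset[OF assms(4,1)])
  have fin: "finite D" "finite V" using fD finite_subset[OF assms(5) fD] by auto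
  have "\<epsilon> ^ card B * (1 - \<epsilon>) ^ card (U - D - B) * ((1 - \<epsilon>) ^ card D * (\<epsilon> ^ card V * g (B \<union> V)))
      \<le> \<epsilon> ^ card (B \<union> V) * (1 - \<epsilon>) ^ card (U - (B \<union> V)) * g (B \<union> V)" if "B \<in> Pow (U - D)" for B
  proof -
    have fB: "finite B" using that assms(1) by (auto intro: finite_subset[of B U])
    have c1: "card (B \<union> V) = card B + card V"
      using that assms(5) fB fin by (intro card_Un_disjoint) auto
    have "U - (B \<union> V) = (U - D - B) \<union> (D - V)" using that assms(4,5) by auto
    hence c2: "card (U - (B \<union> V)) = card (U - D - B) + card (D - V)"
      using assms(1) fin by (simp add: card_Un_disjoint Int_Diff disjoint_iff)
    have "(1 - \<epsilon>) ^ card D \<le> (1 - \<epsilon>) ^ card (D - V)"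
      using assms fin by (intro power_decreasing card_mono) auto
    hence "(\<epsilon> ^ card B * (1 - \<epsilon>) ^ card (U - D - B) * \<epsilon> ^ card V * g (B \<union> V)) * (1 - \<epsilon>) ^ card D
       \<le> (\<epsilon> ^ card B * (1 - \<epsilon>) ^ card (U - D - B) * \<epsilon> ^ card V * g (B \<union> V)) * (1 - \<epsilon>) ^ card (D - V)"
      using assms by (intro mult_left_mono) auto
    thus ?thesis by (simp add: c1 c2 power_add mult_ac)
  qed
  hence "(\<Sum>B\<in>Pow (U - D). \<epsilon> ^ card B * (1 - \<epsilon>) ^ card (U - D - B) *
            ((1 - \<epsilon>) ^ card D * (\<epsilon> ^ card V * g (B \<union> V))))
     \<le> (\<Sum>B\<in>Pow (U - D). \<epsilon> ^ card (B \<union> V) * (1 - \<epsilon>) ^ card (U - (B \<union> V)) * g (B \<union> V))"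
    by (rule sum_mono)
  also have "\<dots> = (\<Sum>B\<in>(\<lambda>B. B \<union> V) ` Pow (U - D). \<epsilon> ^ card B * (1 - \<epsilon>) ^ card (U - B) * g B)"
    using assms(5) by (subst sum.reindex) (auto intro!: inj_onI)
  also have "\<dots> \<le> (\<Sum>B\<in>Pow U. \<epsilon> ^ card B * (1 - \<epsilon>) ^ card (U - B) * g B)"
    using assms by (intro sum_mono2) auto
  finally show ?thesis .
qed

text \<open>\<open>\<Psi> \<beta> i\<close> stands for the risk of a sign error at \<open>i\<close>
  under the coefficients \<open>\<beta>\<close>, and \<open>S\<close> for the worst case over
  signals, which dominates any average. For a block \<open>j\<close> the configurations
  \<open>T\<close> and \<open>insert j T\<close> are paired and the support outside
  \<open>D j\<close> is frozen: the two coefficient vectors then agree off \<open>D j\<close>, which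
  is the situation of \<open>two_point\<close>.\<close>

lemma Bayes_risk_ge_sum_blocks:
  fixes \<Psi> :: "('a \<Rightarrow> real) \<Rightarrow> 'a \<Rightarrow> real" and \<epsilon> S :: real
    and D V0 V1 :: "'b \<Rightarrow> 'a set" and A :: "'a \<Rightarrow> real set"
  assumes fin: "finite U" "finite I" and eps: "0 \<le> \<epsilon>" "\<epsilon> \<le> 1"
    and nonneg: "\<And>\<beta> i. 0 \<le> \<Psi> \<beta> i"
    and disj: "\<And>j k. j \<in> I \<Longrightarrow> k \<in> I \<Longrightarrow> j \<noteq> k \<Longrightarrow> D j \<inter> D k = {}"
    and D: "\<And>j. j \<in> I \<Longrightarrow> D j \<subseteq> U \<and> V0 j \<subseteq> D j \<and> V1 j \<subseteq> D j \<and> x j \<in> D j"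
    and A: "\<And>i. base i \<in> A i" "\<And>i j. j \<in> I \<Longrightarrow> m0 j i \<in> A i \<and> m1 j i \<in> A i"
    and risk: "\<And>\<mu>. (\<And>i. \<mu> i \<in> A i) \<Longrightarrow>
      (\<Sum>B\<in>Pow U. \<epsilon> ^ card B * (1 - \<epsilon>) ^ card (U - B) *
         (\<Sum>i\<in>U. \<Psi> (\<lambda>i. if i \<in> B then \<mu> i else 0) i)) \<le> S"
    and two_point: "\<And>j \<beta>0 \<beta>1. j \<in> I \<Longrightarrow>
      (\<And>i. i \<in> D j \<Longrightarrow> \<beta>0 i = (if i \<in> V0 j then m0 j i else 0)) \<Longrightarrow>
      (\<And>i. i \<in> D j \<Longrightarrow> \<beta>1 i = (if i \<in> V1 j then m1 j i else 0)) \<Longrightarrow>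
      (\<And>i. i \<notin> D j \<Longrightarrow> \<beta>0 i = \<beta>1 i) \<Longrightarrow>
      c j \<le> \<epsilon> ^ card (V0 j) * \<Psi> \<beta>0 (x j) + \<epsilon> ^ card (V1 j) * \<Psi> \<beta>1 (x j)"
  shows "(\<Sum>j\<in>I. (1 - \<epsilon>) ^ card (D j) * c j / 2) \<le> S"
proof -
  \<comment> \<open>Uniform prior on the subsets T of I: the block of j carries m1 j if j is in T, else m0 j.\<close>
  define blk where "blk i = (THE j. j \<in> I \<and> i \<in> D j)" for i
  define \<mu> where "\<mu> T i = (if \<exists>j\<in>I. i \<in> D j
      then if blk i \<in> T then m1 (blk i) i else m0 (blk i) i else base i)" for T i
  define \<beta> where "\<beta> T B = (\<lambda>i. if i \<in> B then \<mu> T i else 0)" for T B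
  define wt where "wt B = \<epsilon> ^ card B * (1 - \<epsilon>) ^ card (U - B)" for B
  have wt0: "0 \<le> wt B" for B using eps by (simp add: wt_def)
  have blk: "blk i = j" if "j \<in> I" "i \<in> D j" for i j
    unfolding blk_def using that disj by (intro the_equality) blast+
  have \<mu>_blk: "\<mu> T i = (if j \<in> T then m1 j i else m0 j i)" if "j \<in> I" "i \<in> D j" for T i j
    using that blk[OF that] by (auto simp: \<mu>_def)
  have \<mu>_other: "\<mu> (insert j T) i = \<mu> T i" if "j \<in> I" "i \<notin> D j" for T i j
    using that blk by (auto simp: \<mu>_def)
  have step1: "(\<Sum>B\<in>Pow U. wt B * (\<Sum>j\<in>I. \<Psi> (\<beta> T B) (x j))) \<le> S" if "T \<in> Pow I" for T
  proof -
    \<comment> \<open>Disjoint blocks have distinct designated coordinates, so charging only these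
      undercounts the total loss.\<close>
    have inj: "inj_on x I" using disj D by (intro inj_onI) (metis disjoint_iff)
    have "(\<Sum>j\<in>I. \<Psi> (\<beta> T B) (x j)) \<le> (\<Sum>i\<in>U. \<Psi> (\<beta> T B) i)" for B
    proof -
      have "(\<Sum>j\<in>I. \<Psi> (\<beta> T B) (x j)) = (\<Sum>i\<in>x ` I. \<Psi> (\<beta> T B) i)"
        by (simp add: sum.reindex[OF inj])
      also have "\<dots> \<le> (\<Sum>i\<in>U. \<Psi> (\<beta> T B) i)"
        using D fin nonneg by (intro sum_mono2) auto
      finally show ?thesis .
    qed
    hence "(\<Sum>B\<in>Pow U. wt B * (\<Sum>j\<in>I. \<Psi> (\<beta> T B) (x j)))
         \<le> (\<Sum>B\<in>Pow U. wt B * (\<Sum>i\<in>U. \<Psi> (\<beta> T B) i))"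
      by (intro sum_mono mult_left_mono wt0)
    also have "\<dots> \<le> S"
      unfolding wt_def \<beta>_def
    proof (rule risk)
      fix i
      show "\<mu> T i \<in> A i" using A blk by (cases "\<exists>j\<in>I. i \<in> D j") (auto simp: \<mu>_def)
    qed
    finally show ?thesis .
  qed
  have step2: "2 ^ card I * ((1 - \<epsilon>) ^ card (D j) * c j / 2)
      \<le> (\<Sum>T\<in>Pow I. \<Sum>B\<in>Pow U. wt B * \<Psi> (\<beta> T B) (x j))" if j: "j \<in> I" for j
  proof -
    let ?w = "\<lambda>B. \<epsilon> ^ card B * (1 - \<epsilon>) ^ card (U - D j - B)"
    have Dj: "D j \<subseteq> U" "V0 j \<subseteq> D j" "V1 j \<subseteq> D j" using D[OF j] by auto
    have one: "(1 - \<epsilon>) ^ card (D j) * c j \<le> (\<Sum>B\<in>Pow U. wt B * \<Psi> (\<beta> T B) (x j)) +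
        (\<Sum>B\<in>Pow U. wt B * \<Psi> (\<beta> (insert j T) B) (x j))" if T: "T \<in> Pow (I - {j})" for T
    proof -
      \<comment> \<open>The constant is multiplied by the total weight 1 of the supports outside the
        block, which turns the two-point bound into an average over them.\<close>
      have "(1 - \<epsilon>) ^ card (D j) * c j
          = (\<Sum>B\<in>Pow (U - D j). ?w B) * ((1 - \<epsilon>) ^ card (D j) * c j)"
        using sum_Pow_Bernoulli[of "U - D j" \<epsilon>] fin by simp
      also have "\<dots> = (\<Sum>B\<in>Pow (U - D j). ?w B * ((1 - \<epsilon>) ^ card (D j) * c j))"
        by (rule sum_distrib_right)
      also have "\<dots> \<le> (\<Sum>B\<in>Pow (U - D j). ?w B * ((1 - \<epsilon>) ^ card (D j) *
           (\<epsilon> ^ card (V0 j) * \<Psi> (\<beta> T (B \<union> V0 j)) (x j) +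
            \<epsilon> ^ card (V1 j) * \<Psi> (\<beta> (insert j T) (B \<union> V1 j)) (x j))))"
      proof (intro sum_mono mult_left_mono two_point j)
        fix B i assume B: "B \<in> Pow (U - D j)"
        show "\<beta> T (B \<union> V0 j) i = (if i \<in> V0 j then m0 j i else 0)" if "i \<in> D j"
          using that B T j \<mu>_blk[OF j that] by (auto simp: \<beta>_def)
        show "\<beta> (insert j T) (B \<union> V1 j) i = (if i \<in> V1 j then m1 j i else 0)" if "i \<in> D j"
          using that B T j \<mu>_blk[OF j that] by (auto simp: \<beta>_def)
        show "\<beta> T (B \<union> V0 j) i = \<beta> (insert j T) (B \<union> V1 j) i" if "i \<notin> D j"
          using that Dj \<mu>_other[OF j that] by (auto simp: \<beta>_def)
      qed (use eps in auto)
      also have "\<dots> = (\<Sum>B\<in>Pow (U - D j). ?w B * ((1 - \<epsilon>) ^ card (D j) *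
            (\<epsilon> ^ card (V0 j) * \<Psi> (\<beta> T (B \<union> V0 j)) (x j)))) +
          (\<Sum>B\<in>Pow (U - D j). ?w B * ((1 - \<epsilon>) ^ card (D j) *
            (\<epsilon> ^ card (V1 j) * \<Psi> (\<beta> (insert j T) (B \<union> V1 j)) (x j))))"
        by (simp add: ring_distribs sum.distrib)
      also have "\<dots> \<le> (\<Sum>B\<in>Pow U. wt B * \<Psi> (\<beta> T B) (x j)) +
        (\<Sum>B\<in>Pow U. wt B * \<Psi> (\<beta> (insert j T) B) (x j))"
        unfolding wt_def using fin eps Dj nonneg
        by (intro add_mono Bernoulli_sum_ge_block)
      finally show ?thesis .
    qed
    \<comment> \<open>The pairing leaves half of the subsets of \<open>I\<close>; this is the origin
      of the factor 1/2 in the conclusion.\<close>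
    have "2 ^ card I * ((1 - \<epsilon>) ^ card (D j) * c j / 2)
        = (\<Sum>T\<in>Pow (I - {j}). (1 - \<epsilon>) ^ card (D j) * c j)"
    proof -
      have "card I = Suc (card (I - {j}))" using j fin by (metis card_Suc_Diff1)
      thus ?thesis using fin by (simp add: card_Pow)
    qed
    also have "\<dots> \<le> (\<Sum>T\<in>Pow (I - {j}). (\<Sum>B\<in>Pow U. wt B * \<Psi> (\<beta> T B) (x j)) +
        (\<Sum>B\<in>Pow U. wt B * \<Psi> (\<beta> (insert j T) B) (x j)))"
      by (intro sum_mono one)
    also have "\<dots> = (\<Sum>T\<in>Pow I. \<Sum>B\<in>Pow U. wt B * \<Psi> (\<beta> T B) (x j))"
      by (rule sum_Pow_insert[symmetric, OF fin(2) j])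
    finally show ?thesis .
  qed
  have "2 ^ card I * (\<Sum>j\<in>I. (1 - \<epsilon>) ^ card (D j) * c j / 2)
      = (\<Sum>j\<in>I. 2 ^ card I * ((1 - \<epsilon>) ^ card (D j) * c j / 2))"
    by (rule sum_distrib_left)
  also have "\<dots> \<le> (\<Sum>j\<in>I. \<Sum>T\<in>Pow I. \<Sum>B\<in>Pow U. wt B * \<Psi> (\<beta> T B) (x j))"
    by (intro sum_mono step2)
  also have "\<dots> = (\<Sum>T\<in>Pow I. \<Sum>j\<in>I. \<Sum>B\<in>Pow U. wt B * \<Psi> (\<beta> T B) (x j))"
    by (rule sum.swap)
  also have "\<dots> = (\<Sum>T\<in>Pow I. \<Sum>B\<in>Pow U. wt B * (\<Sum>j\<in>I. \<Psi> (\<beta> T B) (x j)))"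
    unfolding sum_distrib_left by (intro sum.cong refl sum.swap)
  also have "\<dots> \<le> (\<Sum>T\<in>Pow I. S)" by (intro sum_mono step1)
  also have "\<dots> = 2 ^ card I * S" using fin by (simp add: card_Pow)
  finally show ?thesis by simp
qed

section \<open>Gaussian product measures\<close>

interpretation std_normal: prob_space std_normal_measure
  unfolding std_normal_measure_def by (rule prob_space_normal_density) simp

lemma sets_std_normal_measure [measurable_cong, simp]: "sets std_normal_measure = sets borel"
  by (simp add: std_normal_measure_def)

lemma space_std_normal_measure [simp]: "space std_normal_measure = UNIV"
  by (simp add: std_normal_measure_def)

interpretation std_normal_product: product_sigma_finite "\<lambda>_. std_normal_measure"
  by standard

text \<open>The Cameron-Martin formula in one dimension, obtained from the translation invariance of
  Lebesgue measure.\<close>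

lemma std_normal_shift:
  assumes [measurable]: "f \<in> borel_measurable borel"
  shows "(\<integral>\<^sup>+x. f x \<partial>std_normal_measure) =
    (\<integral>\<^sup>+x. f (x + u) * ennreal (exp (- u * x - u\<^sup>2 / 2)) \<partial>std_normal_measure)"
proof -
  have *: "std_normal_density (u + x) = std_normal_density x * exp (- u * x - u\<^sup>2 / 2)" for x
    by (simp add: std_normal_density_def exp_add[symmetric] power2_eq_square field_simps)
  have "(\<integral>\<^sup>+x. f x \<partial>std_normal_measure) = (\<integral>\<^sup>+x. ennreal (std_normal_density x) * f x \<partial>lborel)"
    unfolding std_normal_measure_def by (simp add: nn_integral_density)
  also have "\<dots> = (\<integral>\<^sup>+x. ennreal (std_normal_density (u + x)) * f (u + x) \<partial>lborel)"
    by (subst nn_integral_real_affine[where t = u and c = 1]) auto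
  also have "\<dots> = (\<integral>\<^sup>+x. ennreal (std_normal_density x) *
      (f (x + u) * ennreal (exp (- u * x - u\<^sup>2 / 2))) \<partial>lborel)"
    unfolding * add.commute[of _ u] by (intro nn_integral_cong) (simp add: ennreal_mult mult_ac)
  also have "\<dots> = (\<integral>\<^sup>+x. f (x + u) * ennreal (exp (- u * x - u\<^sup>2 / 2)) \<partial>std_normal_measure)"
    unfolding std_normal_measure_def by (simp add: nn_integral_density)
  finally show ?thesis .
qed

text \<open>Tonelli reduces the shift to one coordinate at a time and the exponents add up. With
  nonnegative integrals only measurability of \<open>F\<close> has to be carried through the
  induction.\<close>

lemma std_normal_product_shift:
  assumes "finite I" "F \<in> borel_measurable (PiM I (\<lambda>_. std_normal_measure))"
  shows "(\<integral>\<^sup>+z. F z \<partial>PiM I (\<lambda>_. std_normal_measure)) =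
    (\<integral>\<^sup>+z. F (\<lambda>i\<in>I. z i + u i) * ennreal (exp (- (\<Sum>i\<in>I. u i * z i) - (\<Sum>i\<in>I. (u i)\<^sup>2) / 2))
       \<partial>PiM I (\<lambda>_. std_normal_measure))"
  using assms
proof (induction I arbitrary: F rule: finite_induct)
  case empty
  show ?case by (intro nn_integral_cong) (simp add: space_PiM)
next
  case (insert i I)
  let ?N = "\<lambda>_. std_normal_measure"
  have [measurable]: "F \<in> borel_measurable (PiM (insert i I) ?N)" by fact
  note insert.hyps(1)[simp]
  define E where "E z = ennreal (exp (- (\<Sum>i\<in>I. u i * z i) - (\<Sum>i\<in>I. (u i)\<^sup>2) / 2))" for z
  define e where "e y = ennreal (exp (- u i * y - (u i)\<^sup>2 / 2))" for y
  have [measurable]: "E \<in> borel_measurable (PiM I ?N)" unfolding E_def by measurable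
  have [measurable]: "e \<in> borel_measurable borel" unfolding e_def by measurable
  have fst_upd[measurable]: "(\<lambda>(x, y). x(i := y + c)) \<in> measurable (PiM I ?N \<Otimes>\<^sub>M std_normal_measure) (PiM (insert i I) ?N)" for c
    by measurable
  define G where "G x = (\<integral>\<^sup>+y. F (x(i := y + u i)) * e y \<partial>std_normal_measure)" for x
  have [measurable]: "G \<in> borel_measurable (PiM I ?N)"
    unfolding G_def by measurable
  have "(\<integral>\<^sup>+z. F z \<partial>PiM (insert i I) ?N) =
      (\<integral>\<^sup>+x. (\<integral>\<^sup>+y. F (x(i := y)) \<partial>std_normal_measure) \<partial>PiM I ?N)"
    by (rule std_normal_product.product_nn_integral_insert) (use insert in auto)
  also have "\<dots> = (\<integral>\<^sup>+x. G x \<partial>PiM I ?N)"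
  proof (intro nn_integral_cong)
    fix x assume [measurable]: "x \<in> space (PiM I ?N)"
    have "(\<lambda>y. F (x(i := y))) \<in> borel_measurable std_normal_measure" by measurable
    hence "(\<lambda>y. F (x(i := y))) \<in> borel_measurable borel" by (simp cong: measurable_cong_sets)
    from std_normal_shift[OF this, of "u i"]
    show "(\<integral>\<^sup>+y. F (x(i := y)) \<partial>std_normal_measure) = G x" by (simp only: G_def e_def)
  qed
  also have "\<dots> = (\<integral>\<^sup>+x. G (\<lambda>i\<in>I. x i + u i) * E x \<partial>PiM I ?N)"
    unfolding E_def by (rule insert.IH) measurable
  also have "\<dots> = (\<integral>\<^sup>+x. (\<integral>\<^sup>+y. F ((\<lambda>k\<in>I. x k + u k)(i := y + u i)) * e y * E x \<partial>std_normal_measure) \<partial>PiM I ?N)"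
  proof (intro nn_integral_cong)
    fix x assume "x \<in> space (PiM I ?N)"
    have "G x' * c = (\<integral>\<^sup>+y. F (x'(i := y + u i)) * e y * c \<partial>std_normal_measure)"
      if [measurable]: "x' \<in> space (PiM I ?N)" for x' c
    proof -
      have "(\<lambda>y. F (x'(i := y + u i)) * e y) \<in> borel_measurable std_normal_measure" by measurable
      thus ?thesis unfolding G_def by (simp add: nn_integral_multc)
    qed
    thus "G (\<lambda>i\<in>I. x i + u i) * E x =
      (\<integral>\<^sup>+y. F ((\<lambda>k\<in>I. x k + u k)(i := y + u i)) * e y * E x \<partial>std_normal_measure)"
      by (auto simp: space_PiM)
  qed
  also have "\<dots> = (\<integral>\<^sup>+x. (\<integral>\<^sup>+y. F (\<lambda>k\<in>insert i I. (x(i := y)) k + u k) *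
      ennreal (exp (- (\<Sum>k\<in>insert i I. u k * (x(i := y)) k) - (\<Sum>k\<in>insert i I. (u k)\<^sup>2) / 2))
      \<partial>std_normal_measure) \<partial>PiM I ?N)"
  proof (intro nn_integral_cong)
    fix x y
    have "(\<lambda>k\<in>I. x k + u k)(i := y + u i) = (\<lambda>k\<in>insert i I. (x(i := y)) k + u k)"
      using insert.hyps by (auto simp: fun_eq_iff)
    moreover have "(\<Sum>k\<in>I. u k * (x(i := y)) k) = (\<Sum>k\<in>I. u k * x k)"
      using insert.hyps by (intro sum.cong) auto
    hence "e y * E x = ennreal (exp (- (\<Sum>k\<in>insert i I. u k * (x(i := y)) k) - (\<Sum>k\<in>insert i I. (u k)\<^sup>2) / 2))"
      using insert.hyps
      by (simp add: e_def E_def ennreal_mult[symmetric] exp_add[symmetric] add_divide_distrib algebra_simps)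
    ultimately show "F ((\<lambda>k\<in>I. x k + u k)(i := y + u i)) * e y * E x =
       F (\<lambda>k\<in>insert i I. (x(i := y)) k + u k) *
      ennreal (exp (- (\<Sum>k\<in>insert i I. u k * (x(i := y)) k) - (\<Sum>k\<in>insert i I. (u k)\<^sup>2) / 2))"
      by (simp add: mult.assoc)
  qed
  also have "\<dots> = (\<integral>\<^sup>+z. F (\<lambda>k\<in>insert i I. z k + u k) *
      ennreal (exp (- (\<Sum>k\<in>insert i I. u k * z k) - (\<Sum>k\<in>insert i I. (u k)\<^sup>2) / 2))
       \<partial>PiM (insert i I) ?N)"
  proof (rule std_normal_product.product_nn_integral_insert[symmetric])
    have [measurable]: "(\<lambda>z. \<lambda>k\<in>insert i I. z k + u k) \<in> measurable (PiM (insert i I) ?N) (PiM (insert i I) ?N)"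
      by measurable
    show "(\<lambda>z. F (\<lambda>k\<in>insert i I. z k + u k) *
        ennreal (exp (- (\<Sum>k\<in>insert i I. u k * z k) - (\<Sum>k\<in>insert i I. (u k)\<^sup>2) / 2)))
      \<in> borel_measurable (PiM (insert i I) ?N)"
      by measurable
  qed (use insert.hyps in auto)
  finally show ?case .
qed

section \<open>Second moments of Gaussian linear forms and the bounds drawn from them\<close>

lemma std_normal_moments:
  "integrable std_normal_measure (\<lambda>x. x)" "(\<integral>x. x \<partial>std_normal_measure) = 0"
  "integrable std_normal_measure (\<lambda>x. x * x)" "(\<integral>x. x * x \<partial>std_normal_measure) = 1"
proof -
  have *: "integrable std_normal_measure f \<longleftrightarrow> integrable lborel (\<lambda>x. std_normal_density x * f x)"
      "integral\<^sup>L std_normal_measure f = (\<integral>x. std_normal_density x * f x \<partial>lborel)"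
    if "f \<in> borel_measurable borel" for f :: "real \<Rightarrow> real"
    using that unfolding std_normal_measure_def by (simp_all add: integrable_density integral_density)
  show "integrable std_normal_measure (\<lambda>x. x)"
    using integrable_std_normal_moment[of 1] by (simp add: *)
  show "(\<integral>x. x \<partial>std_normal_measure) = 0"
    using integral_std_normal_moment_odd[of 0] by (simp add: *)
  show "integrable std_normal_measure (\<lambda>x. x * x)"
    using integrable_std_normal_moment[of 2] by (simp add: * power2_eq_square)
  show "(\<integral>x. x * x \<partial>std_normal_measure) = 1"
    using integral_std_normal_moment_even[of 1] by (simp add: * power2_eq_square)
qed

lemma std_normal_product_second_moment:
  assumes "finite I"
  shows "has_bochner_integral (PiM I (\<lambda>_. std_normal_measure)) (\<lambda>z. (\<Sum>l\<in>I. c l * z l)\<^sup>2) (\<Sum>l\<in>I. (c l)\<^sup>2)"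
proof -
  let ?P = "PiM I (\<lambda>_. std_normal_measure)"
  have mom: "has_bochner_integral ?P (\<lambda>z. z i * z k) (if i = k then 1 else 0)" if ik: "i \<in> I" "k \<in> I" for i k
  proof -
    \<comment> \<open>The monomial in \<open>z i\<close> and \<open>z k\<close> is written as a
      product over all coordinates, with factor 1 elsewhere, so that the integral splits into
      one-dimensional ones; for \<open>i = k\<close> the factor at \<open>i\<close> is a
      square.\<close>
    define f :: "_ \<Rightarrow> real \<Rightarrow> real" where "f l x = (if l = i then x else 1) * (if l = k then x else 1)" for l x
    have int: "integrable std_normal_measure (f l)" for l
      using std_normal_moments by (cases "l = i"; cases "l = k") (simp_all add: f_def[abs_def])
    have "(\<Prod>l\<in>I. f l (z l)) = z i * z k" for z
      using ik assms by (simp add: f_def prod.distrib)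
    moreover have "(\<Prod>l\<in>I. integral\<^sup>L std_normal_measure (f l)) = (if i = k then 1 else 0)"
    proof (cases "i = k")
      case True
      have "integral\<^sup>L std_normal_measure (f l) = 1" for l
        using std_normal_moments std_normal.prob_space True
        by (cases "l = i") (simp_all add: f_def[abs_def])
      thus ?thesis using True by simp
    next
      case False
      hence "integral\<^sup>L std_normal_measure (f i) = 0"
        using std_normal_moments by (simp add: f_def[abs_def])
      hence "(\<Prod>l\<in>I. integral\<^sup>L std_normal_measure (f l)) = 0"
        using ik assms by (intro prod_zero) auto
      thus ?thesis using False by simp
    qed
    ultimately show ?thesis
      using std_normal_product.product_integrable_prod[of I f, OF assms int]
        std_normal_product.product_integral_prod[of I f, OF assms int]
      by (simp add: has_bochner_integral_iff)
  qed
  have "has_bochner_integral ?P (\<lambda>z. \<Sum>i\<in>I. \<Sum>k\<in>I. (c i * c k) * (z i * z k))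
     (\<Sum>i\<in>I. \<Sum>k\<in>I. (c i * c k) * (if i = k then 1 else 0))"
    by (intro has_bochner_integral_sum has_bochner_integral_mult_right mom)
  moreover have "(\<Sum>i\<in>I. \<Sum>k\<in>I. (c i * c k) * (if i = k then 1 else 0)) = (\<Sum>l\<in>I. (c l)\<^sup>2)"
    using assms by (intro sum.cong refl) (simp add: power2_eq_square mult_delta_right)
  moreover have "(\<Sum>i\<in>I. \<Sum>k\<in>I. (c i * c k) * (z i * z k)) = (\<Sum>l\<in>I. c l * z l)\<^sup>2" for z :: "_ \<Rightarrow> real"
    by (simp add: power2_eq_square sum_product mult_ac)
  ultimately show ?thesis by simp
qed

text \<open>Chebyshev in integrated form: exp (- |y|) is at least exp (- K) (1 - y^2 / K^2), since
  the right side is nonpositive as soon as |y| exceeds K, and the variance of y is at most K^2 /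
  2.\<close>

lemma std_normal_exp_abs_linear:
  assumes "finite I" "2 * (\<Sum>l\<in>I. (c l)\<^sup>2) \<le> K\<^sup>2" "0 < K"
  shows "ennreal (exp (- K) / 2) \<le> (\<integral>\<^sup>+z. ennreal (exp (- \<bar>\<Sum>l\<in>I. c l * z l\<bar>)) \<partial>PiM I (\<lambda>_. std_normal_measure))"
proof -
  let ?P = "PiM I (\<lambda>_. std_normal_measure)" and ?y = "\<lambda>z. \<Sum>l\<in>I. c l * z l"
  interpret P: prob_space ?P by (intro prob_space_PiM) unfold_locales
  note sm = std_normal_product_second_moment[OF assms(1), of c]
  have int: "integrable ?P (\<lambda>z. exp (- \<bar>?y z\<bar>))"
    using assms(1) by (intro P.integrable_const_bound[where B = 1]) (auto, measurable)
  have ptw: "exp (- K) * (1 - y\<^sup>2 / K\<^sup>2) \<le> exp (- \<bar>y\<bar>)" for y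
  proof (cases "\<bar>y\<bar> \<le> K")
    case True
    have "exp (- K) * (1 - y\<^sup>2 / K\<^sup>2) \<le> exp (- K) * 1" by (intro mult_left_mono) auto
    also have "\<dots> \<le> exp (- \<bar>y\<bar>)" using True by simp
    finally show ?thesis .
  next
    case False
    hence "1 - y\<^sup>2 / K\<^sup>2 \<le> 0" using assms(3) by (simp add: divide_simps abs_le_square_iff[symmetric])
    hence "exp (- K) * (1 - y\<^sup>2 / K\<^sup>2) \<le> 0" by (simp add: mult_le_0_iff)
    thus ?thesis using exp_ge_zero order_trans by blast
  qed
  have "exp (- K) / 2 \<le> exp (- K) * (1 - (\<Sum>l\<in>I. (c l)\<^sup>2) / K\<^sup>2)"
    using assms(2,3) by (simp add: field_simps)
  also have "\<dots> = (\<integral>z. exp (- K) * (1 - (?y z)\<^sup>2 / K\<^sup>2) \<partial>?P)"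
    using sm by (simp add: has_bochner_integral_iff P.prob_space)
  also have "\<dots> \<le> (\<integral>z. exp (- \<bar>?y z\<bar>) \<partial>?P)"
    by (intro integral_mono int ptw) (use sm in \<open>simp add: has_bochner_integral_iff\<close>)
  finally show ?thesis using int by (subst nn_integral_eq_integral) auto
qed

text \<open>Here \<open>q\<close> is the mean of the quadratic form, and the indicator dominates 1 -
  Q / ((1 + \<delta>) q). Only an upper bound on the form is wanted, since a smaller separation
  makes the test harder; a probability bounded away from 0 is enough because constants are absorbed
  in the end.\<close>

lemma std_normal_Markov_quadratic:
  assumes "finite I" "finite M" "(\<Sum>m\<in>M. \<Sum>l\<in>I. (c m l)\<^sup>2) = q" "0 < q" "0 < \<delta>"
  shows "ennreal (\<delta> / (1 + \<delta>)) \<le>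
    (\<integral>\<^sup>+z. (if (\<Sum>m\<in>M. (\<Sum>l\<in>I. c m l * z l)\<^sup>2) \<le> (1 + \<delta>) * q then 1 else 0) \<partial>PiM I (\<lambda>_. std_normal_measure))"
proof -
  let ?P = "PiM I (\<lambda>_. std_normal_measure)" and ?Q = "\<lambda>z. \<Sum>m\<in>M. (\<Sum>l\<in>I. c m l * z l)\<^sup>2"
  interpret P: prob_space ?P by (intro prob_space_PiM) unfold_locales
  have sm: "has_bochner_integral ?P ?Q q"
    unfolding assms(3)[symmetric]
    by (intro has_bochner_integral_sum std_normal_product_second_moment assms)
  define h where "h z = (if ?Q z \<le> (1 + \<delta>) * q then 1 else 0 :: real)" for z
  have [measurable]: "?Q \<in> borel_measurable ?P" using sm by (simp add: has_bochner_integral_iff)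
  have int: "integrable ?P h"
    unfolding h_def by (intro P.integrable_const_bound[where B = 1]) (auto, measurable)
  have "0 \<le> ?Q z" for z by (intro sum_nonneg) auto
  hence ptw: "1 - ?Q z / ((1 + \<delta>) * q) \<le> h z" for z
    using assms(4,5) by (cases "?Q z \<le> (1 + \<delta>) * q") (auto simp: h_def le_divide_eq not_le)
  have "q / ((1 + \<delta>) * q) = 1 / (1 + \<delta>)" using assms(4) by simp
  hence "\<delta> / (1 + \<delta>) = 1 - q / ((1 + \<delta>) * q)" using assms(5) by (simp add: field_simps)
  also have "\<dots> = (\<integral>z. 1 - ?Q z / ((1 + \<delta>) * q) \<partial>?P)"
    using sm by (simp add: has_bochner_integral_iff P.prob_space)
  also have "\<dots> \<le> (\<integral>z. h z \<partial>?P)"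
    by (intro integral_mono int ptw) (use sm in \<open>simp add: has_bochner_integral_iff\<close>)
  finally have "ennreal (\<delta> / (1 + \<delta>)) \<le> ennreal (\<integral>z. h z \<partial>?P)" by (rule ennreal_leI)
  also have "\<dots> = (\<integral>\<^sup>+z. ennreal (h z) \<partial>?P)"
    by (rule nn_integral_eq_integral[symmetric, OF int]) (simp add: h_def)
  also have "\<dots> = (\<integral>\<^sup>+z. (if ?Q z \<le> (1 + \<delta>) * q then 1 else 0) \<partial>?P)"
    by (intro nn_integral_cong) (simp add: h_def)
  finally show ?thesis .
qed

text \<open>\<open>F0\<close> and \<open>F1\<close> are the error indicators of one decision under
  the two hypotheses, and their sum is at least 1 because no decision is right for both. After the
  shift to a common mean both likelihood weights are at least m exp (- |y|), so whichever error
  occurs costs that much.\<close>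

lemma Gaussian_two_point:
  fixes F0 F1 :: "('i \<Rightarrow> real) \<Rightarrow> real"
  assumes "finite I" and [measurable]: "F0 \<in> borel_measurable (PiM I (\<lambda>_. borel))"
      "F1 \<in> borel_measurable (PiM I (\<lambda>_. borel))"
    and F: "\<And>y. 0 \<le> F0 y" "\<And>y. 0 \<le> F1 y" "\<And>y. 1 \<le> F0 y + F1 y"
    and w: "0 \<le> w0" "0 \<le> w1" and "0 < \<sigma>" and s: "0 \<le> s" "s \<le> 1"
    and V: "(\<Sum>i\<in>I. ((m1 i - m0 i) / \<sigma>)\<^sup>2) \<le> V" "2 * V \<le> K\<^sup>2" "0 < K"
    and m: "m \<le> w0 * exp (- s\<^sup>2 * V / 2)" "m \<le> w1 * exp (- (1 - s)\<^sup>2 * V / 2)" "0 \<le> m"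
  shows "ennreal (m * (exp (- K) / 2)) \<le>
    (\<integral>\<^sup>+z. ennreal (w0 * F0 (\<lambda>i\<in>I. m0 i + \<sigma> * z i)) \<partial>PiM I (\<lambda>_. std_normal_measure)) +
    (\<integral>\<^sup>+z. ennreal (w1 * F1 (\<lambda>i\<in>I. m1 i + \<sigma> * z i)) \<partial>PiM I (\<lambda>_. std_normal_measure))"
proof -
  let ?P = "PiM I (\<lambda>_. std_normal_measure)"
  have setsP: "sets ?P = sets (PiM I (\<lambda>_. borel :: real measure))"
    by (intro sets_PiM_cong) auto
  have [measurable]: "F0 \<in> borel_measurable ?P" "F1 \<in> borel_measurable ?P"
    using assms(2,3) by (simp_all cong: measurable_cong_sets add: setsP)
  define v where "v i = (m1 i - m0 i) / \<sigma>" for i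
  define q where "q = (\<Sum>i\<in>I. (v i)\<^sup>2)"
  define y where "y z = (\<Sum>i\<in>I. v i * z i)" for z :: "'i \<Rightarrow> real"
  \<comment> \<open>Both hypotheses are shifted to the common mean m0 + s (m1 - m0).\<close>
  define M where "M z = (\<lambda>i\<in>I. m0 i + s * (m1 i - m0 i) + \<sigma> * z i)" for z
  have [measurable]: "y \<in> borel_measurable ?P" unfolding y_def by measurable
  have [measurable]: "M \<in> measurable ?P ?P" unfolding M_def by measurable
  have affine[measurable]: "(\<lambda>z. \<lambda>i\<in>I. mm i + \<sigma> * z i) \<in> measurable ?P ?P" for mm :: "'i \<Rightarrow> real"
    by measurable
  have qV: "q \<le> V" using V(1) by (simp add: q_def v_def)
  have s0: "(\<integral>\<^sup>+z. ennreal (w0 * F0 (\<lambda>i\<in>I. m0 i + \<sigma> * z i)) \<partial>?P) =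
    (\<integral>\<^sup>+z. ennreal (w0 * F0 (M z) * exp (- s * y z - s\<^sup>2 * q / 2)) \<partial>?P)"
  \<comment> \<open>In noise units the way from \<open>m0\<close> to \<open>m1\<close> is
    \<open>v\<close>; the fraction \<open>s\<close> of it is covered from this side.\<close>
  proof (subst std_normal_product_shift[where u = "\<lambda>i. s * v i"])
    show "(\<lambda>z. ennreal (w0 * F0 (\<lambda>i\<in>I. m0 i + \<sigma> * z i))) \<in> borel_measurable ?P" by measurable
    have "(\<lambda>i\<in>I. m0 i + \<sigma> * (\<lambda>i\<in>I. z i + s * v i) i) = M z" for z
      using \<open>0 < \<sigma>\<close> by (auto simp: M_def v_def fun_eq_iff field_simps)
    moreover have "(\<Sum>i\<in>I. s * v i * z i) = s * y z" "(\<Sum>i\<in>I. (s * v i)\<^sup>2) = s\<^sup>2 * q" for z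
      by (simp_all add: y_def q_def sum_distrib_left power_mult_distrib mult.assoc)
    ultimately show "(\<integral>\<^sup>+z. ennreal (w0 * F0 (\<lambda>i\<in>I. m0 i + \<sigma> * (\<lambda>i\<in>I. z i + s * v i) i)) *
        ennreal (exp (- (\<Sum>i\<in>I. s * v i * z i) - (\<Sum>i\<in>I. (s * v i)\<^sup>2) / 2)) \<partial>?P) =
      (\<integral>\<^sup>+z. ennreal (w0 * F0 (M z) * exp (- s * y z - s\<^sup>2 * q / 2)) \<partial>?P)"
      using F w by (intro nn_integral_cong) (simp add: ennreal_mult)
  qed fact
  have s1: "(\<integral>\<^sup>+z. ennreal (w1 * F1 (\<lambda>i\<in>I. m1 i + \<sigma> * z i)) \<partial>?P) =
    (\<integral>\<^sup>+z. ennreal (w1 * F1 (M z) * exp ((1 - s) * y z - (1 - s)\<^sup>2 * q / 2)) \<partial>?P)"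
  \<comment> \<open>The remaining fraction 1 - s is covered backwards from \<open>m1\<close>, which
    gives the same argument \<open>M z\<close>.\<close>
  proof (subst std_normal_product_shift[where u = "\<lambda>i. (s - 1) * v i"])
    show "(\<lambda>z. ennreal (w1 * F1 (\<lambda>i\<in>I. m1 i + \<sigma> * z i))) \<in> borel_measurable ?P" by measurable
    have "(\<lambda>i\<in>I. m1 i + \<sigma> * (\<lambda>i\<in>I. z i + (s - 1) * v i) i) = M z" for z
      using \<open>0 < \<sigma>\<close> by (auto simp: M_def v_def fun_eq_iff field_simps)
    moreover have "(\<Sum>i\<in>I. (s - 1) * v i * z i) = (s - 1) * y z"
      "(\<Sum>i\<in>I. ((s - 1) * v i)\<^sup>2) = (1 - s)\<^sup>2 * q" for z
      by (simp_all add: y_def q_def sum_distrib_left power_mult_distrib mult.assoc power2_commute)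
    hence "- (\<Sum>i\<in>I. (s - 1) * v i * z i) - (\<Sum>i\<in>I. ((s - 1) * v i)\<^sup>2) / 2 =
        (1 - s) * y z - (1 - s)\<^sup>2 * q / 2" for z
      by (simp add: left_diff_distrib)
    ultimately show "(\<integral>\<^sup>+z. ennreal (w1 * F1 (\<lambda>i\<in>I. m1 i + \<sigma> * (\<lambda>i\<in>I. z i + (s - 1) * v i) i)) *
        ennreal (exp (- (\<Sum>i\<in>I. (s - 1) * v i * z i) - (\<Sum>i\<in>I. ((s - 1) * v i)\<^sup>2) / 2)) \<partial>?P) =
      (\<integral>\<^sup>+z. ennreal (w1 * F1 (M z) * exp ((1 - s) * y z - (1 - s)\<^sup>2 * q / 2)) \<partial>?P)"
      using F w by (intro nn_integral_cong) (simp add: ennreal_mult)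
  qed fact
  \<comment> \<open>Used with t = - s and t = 1 - s. The actual separation \<open>q\<close> enters
    only through q \<le> V, so one \<open>m\<close> serves every design with that bound.\<close>
  have expo: "m * exp (- \<bar>Y\<bar>) \<le> w * exp (t * Y - t\<^sup>2 * q / 2)"
    if t: "\<bar>t\<bar> \<le> 1" and mw: "m \<le> w * exp (- t\<^sup>2 * V / 2)" and w: "0 \<le> w" for t w Y :: real
  proof -
    have "\<bar>t * Y\<bar> \<le> 1 * \<bar>Y\<bar>" unfolding abs_mult using t by (intro mult_right_mono) auto
    hence 1: "- \<bar>Y\<bar> \<le> t * Y" by linarith
    have "t\<^sup>2 * q \<le> t\<^sup>2 * V" using qV by (intro mult_left_mono) auto
    hence 2: "- t\<^sup>2 * V / 2 + - \<bar>Y\<bar> \<le> t * Y - t\<^sup>2 * q / 2" using 1 by linarith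
    have "m * exp (- \<bar>Y\<bar>) \<le> w * exp (- t\<^sup>2 * V / 2) * exp (- \<bar>Y\<bar>)"
      using mw by (intro mult_right_mono) auto
    also have "\<dots> = w * exp (- t\<^sup>2 * V / 2 + - \<bar>Y\<bar>)" by (simp only: exp_add mult.assoc)
    also have "\<dots> \<le> w * exp (t * Y - t\<^sup>2 * q / 2)" using 2 w by (intro mult_left_mono) auto
    finally show ?thesis .
  qed
  have ptw: "m * exp (- \<bar>y z\<bar>) \<le> w0 * F0 (M z) * exp (- s * y z - s\<^sup>2 * q / 2) +
      w1 * F1 (M z) * exp ((1 - s) * y z - (1 - s)\<^sup>2 * q / 2)" for z
  proof -
    let ?a = "w0 * exp (- s * y z - s\<^sup>2 * q / 2)" and ?b = "w1 * exp ((1 - s) * y z - (1 - s)\<^sup>2 * q / 2)"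
    have a: "m * exp (- \<bar>y z\<bar>) \<le> ?a" using expo[of "- s" w0 "y z"] s m(1) w by simp
    have b: "m * exp (- \<bar>y z\<bar>) \<le> ?b" using expo[of "1 - s" w1 "y z"] s m(2) w by simp
    have "m * exp (- \<bar>y z\<bar>) \<le> m * exp (- \<bar>y z\<bar>) * (F0 (M z) + F1 (M z))"
      using mult_left_mono[OF F(3)[of "M z"], of "m * exp (- \<bar>y z\<bar>)"] m(3) by simp
    also have "\<dots> = m * exp (- \<bar>y z\<bar>) * F0 (M z) + m * exp (- \<bar>y z\<bar>) * F1 (M z)"
      by (simp add: distrib_left)
    also have "\<dots> \<le> ?a * F0 (M z) + ?b * F1 (M z)"
      using a b F by (intro add_mono mult_right_mono)
    finally show ?thesis by (simp add: mult_ac)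
  qed
  have "ennreal (m * (exp (- K) / 2)) = ennreal m * ennreal (exp (- K) / 2)"
    using m(3) by (intro ennreal_mult) auto
  also have "\<dots> \<le> ennreal m * (\<integral>\<^sup>+z. ennreal (exp (- \<bar>y z\<bar>)) \<partial>?P)"
    unfolding y_def using assms(1) V qV
    by (intro mult_left_mono std_normal_exp_abs_linear) (auto simp: q_def)
  also have "\<dots> = (\<integral>\<^sup>+z. ennreal (m * exp (- \<bar>y z\<bar>)) \<partial>?P)"
    using m(3) by (simp add: nn_integral_cmult ennreal_mult)
  also have "\<dots> \<le> (\<integral>\<^sup>+z. ennreal (w0 * F0 (M z) * exp (- s * y z - s\<^sup>2 * q / 2)) +
      ennreal (w1 * F1 (M z) * exp ((1 - s) * y z - (1 - s)\<^sup>2 * q / 2)) \<partial>?P)"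
    using ptw F w by (intro nn_integral_mono) (simp add: ennreal_plus[symmetric] del: ennreal_plus)
  also have "\<dots> = (\<integral>\<^sup>+z. ennreal (w0 * F0 (\<lambda>i\<in>I. m0 i + \<sigma> * z i)) \<partial>?P) +
    (\<integral>\<^sup>+z. ennreal (w1 * F1 (\<lambda>i\<in>I. m1 i + \<sigma> * z i)) \<partial>?P)"
    unfolding s0 s1 by (intro nn_integral_add) measurable
  finally show ?thesis .
qed

section \<open>Sign errors in the linear model\<close>

text \<open>The Gaussian factors of \<open>sample_space\<close>. The Bernoulli factor is kept apart
  because it is summed out over finitely many supports, while the two-point argument works at a
  fixed \<open>\<beta>\<close>.\<close>

definition noise_space :: "nat \<Rightarrow> nat \<Rightarrow> ((nat \<times> nat \<Rightarrow> real) \<times> (nat \<Rightarrow> real)) measure" where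
  "noise_space n p =
     PiM ({..<n} \<times> {..<p}) (\<lambda>_. std_normal_measure) \<Otimes>\<^sub>M PiM {..<n} (\<lambda>_. std_normal_measure)"

definition sign_error where
  "sign_error n p \<sigma> \<Omega> est \<beta> i = (\<lambda>(W, z). let X = design n p \<Omega> W in
     if sgn (est (X, response n p \<sigma> X \<beta> z) i) \<noteq> sgn (\<beta> i) then 1 else 0 :: real)"

definition sign_risk where
  "sign_risk n p \<sigma> \<Omega> est \<beta> i = integral\<^sup>L (noise_space n p) (sign_error n p \<sigma> \<Omega> est \<beta> i)"

lemma prob_space_std_normal_product: "prob_space (PiM I (\<lambda>_. std_normal_measure))"
  by (intro prob_space_PiM) unfold_locales

lemma prob_space_noise_space: "prob_space (noise_space n p)"
  unfolding noise_space_def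
  by (intro prob_space_pair prob_space_std_normal_product)

lemma sqrtm_factorization:
  assumes "corr_matrix p \<Omega>" "i < p" "j < p"
  shows "(\<Sum>k<p. sqrtm p \<Omega> i k * sqrtm p \<Omega> j k) = \<Omega> i j"
proof -
  have "\<exists>L. \<forall>i\<in>{..<p}. \<forall>j\<in>{..<p}. (\<Sum>k\<in>{..<p}. L i k * L j k) = \<Omega> i j"
    using assms(1) by (intro pos_def_factorization) (auto simp: corr_matrix_def quad_def)
  hence "\<exists>L. \<forall>i<p. \<forall>j<p. (\<Sum>k<p. L i k * L j k) = \<Omega> i j" by auto
  from someI_ex[OF this] show ?thesis using assms(2,3) unfolding sqrtm_def by blast
qed

text \<open>With L L' = \<Omega> both sides are the squared norm of L' x; hence a row of the design
  applied to x has variance \<open>quad p \<Omega> x / n\<close>.\<close>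

lemma sum_sqrtm_squares:
  assumes "corr_matrix p \<Omega>"
  shows "(\<Sum>k<p. (\<Sum>j<p. sqrtm p \<Omega> j k * x j)\<^sup>2) = quad p \<Omega> x"
proof -
  have "(\<Sum>k<p. (\<Sum>j<p. sqrtm p \<Omega> j k * x j)\<^sup>2) =
      (\<Sum>k<p. \<Sum>i<p. \<Sum>j<p. x i * (sqrtm p \<Omega> i k * sqrtm p \<Omega> j k) * x j)"
    by (simp add: power2_eq_square sum_product mult_ac)
  also have "\<dots> = (\<Sum>i<p. \<Sum>k<p. \<Sum>j<p. x i * (sqrtm p \<Omega> i k * sqrtm p \<Omega> j k) * x j)"
    by (rule sum.swap)
  also have "\<dots> = (\<Sum>i<p. \<Sum>j<p. \<Sum>k<p. x i * (sqrtm p \<Omega> i k * sqrtm p \<Omega> j k) * x j)"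
    by (intro sum.cong refl sum.swap)
  also have "\<dots> = (\<Sum>i<p. \<Sum>j<p. x i * (\<Sum>k<p. sqrtm p \<Omega> i k * sqrtm p \<Omega> j k) * x j)"
    by (simp add: sum_distrib_left sum_distrib_right)
  also have "\<dots> = quad p \<Omega> x"
    unfolding quad_def using sqrtm_factorization[OF assms] by (intro sum.cong) auto
  finally show ?thesis .
qed

section \<open>Measurability and integrability of sign errors\<close>

lemma design_measurable [measurable]:
  "design n p \<Omega> \<in> measurable (PiM ({..<n} \<times> {..<p}) (\<lambda>_. std_normal_measure)) (PiM ({..<n} \<times> {..<p}) (\<lambda>_. borel))"
  unfolding design_def
proof (rule measurable_restrict)
  fix x assume "x \<in> {..<n} \<times> {..<p}"
  then obtain i j where x: "x = (i, j)" "i < n" "j < p" by auto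
  have [measurable]: "(\<lambda>W. W (i, k)) \<in> borel_measurable (PiM ({..<n} \<times> {..<p}) (\<lambda>_. std_normal_measure))"
    if "k < p" for k
    using measurable_component_singleton[of "(i, k)" "{..<n} \<times> {..<p}" "\<lambda>_. std_normal_measure"] that x
    by (simp cong: measurable_cong_sets)
  show "(\<lambda>W. case x of (i, j) \<Rightarrow> 1 / sqrt (real n) * (\<Sum>k<p. W (i, k) * sqrtm p \<Omega> j k))
     \<in> borel_measurable (PiM ({..<n} \<times> {..<p}) (\<lambda>_. std_normal_measure))"
    unfolding x by (simp del: times_divide_eq_left) measurable
qed

lemma observation_measurable:
  "(\<lambda>(W, z). (design n p \<Omega> W, response n p \<sigma> (design n p \<Omega> W) \<beta> z)) \<in> measurable (noise_space n p) (data_space n p)"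
proof -
  let ?N = "noise_space n p"
  have d[measurable]: "(\<lambda>\<omega>. design n p \<Omega> (fst \<omega>)) \<in> measurable ?N (PiM ({..<n} \<times> {..<p}) (\<lambda>_. borel))"
    unfolding noise_space_def by measurable
  have "(\<lambda>\<omega>. response n p \<sigma> (design n p \<Omega> (fst \<omega>)) \<beta> (snd \<omega>)) \<in> measurable ?N (PiM {..<n} (\<lambda>_. borel))"
    unfolding response_def
  proof (rule measurable_restrict)
    fix i assume i: "i \<in> {..<n}"
    have [measurable]: "(\<lambda>\<omega>. design n p \<Omega> (fst \<omega>) (i, j)) \<in> borel_measurable ?N" if "j < p" for j
      using measurable_compose[OF d measurable_component_singleton[of "(i, j)"]] that i by simp
    have [measurable]: "(\<lambda>\<omega>. snd \<omega> i) \<in> borel_measurable ?N"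
      unfolding noise_space_def using i by measurable
    show "(\<lambda>\<omega>. (\<Sum>j<p. design n p \<Omega> (fst \<omega>) (i, j) * \<beta> j) + \<sigma> * snd \<omega> i) \<in> borel_measurable ?N"
      by measurable
  qed
  thus ?thesis using d unfolding data_space_def case_prod_beta' by (intro measurable_Pair)
qed

lemma sign_error_measurable:
  assumes "est \<in> estimators n p" "i < p"
  shows "sign_error n p \<sigma> \<Omega> est \<beta> i \<in> borel_measurable (noise_space n p)"
proof -
  have "(\<lambda>d. est d i) \<in> borel_measurable (data_space n p)"
    using assms by (auto simp: estimators_def)
  from measurable_compose[OF observation_measurable this]
  have [measurable]: "(\<lambda>\<omega>. est (design n p \<Omega> (fst \<omega>), response n p \<sigma> (design n p \<Omega> (fst \<omega>)) \<beta> (snd \<omega>)) i)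
    \<in> borel_measurable (noise_space n p)"
    by (simp add: case_prod_beta')
  have [measurable]: "(sgn :: real \<Rightarrow> real) \<in> borel_measurable borel"
    unfolding sgn_real_def[abs_def] by measurable
  show ?thesis
    unfolding sign_error_def Let_def case_prod_beta' by measurable
qed

lemma sign_error_bounds: "0 \<le> sign_error n p \<sigma> \<Omega> est \<beta> i \<omega>" "sign_error n p \<sigma> \<Omega> est \<beta> i \<omega> \<le> 1"
  by (auto simp: sign_error_def Let_def case_prod_beta')

lemma integrable_sign_error:
  assumes "est \<in> estimators n p" "i < p"
  shows "integrable (noise_space n p) (sign_error n p \<sigma> \<Omega> est \<beta> i)"
proof -
  interpret prob_space "noise_space n p" by (rule prob_space_noise_space)
  show ?thesis
    by (intro integrable_const_bound[where B = 1] sign_error_measurable assms)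
      (auto simp: sign_error_bounds)
qed

lemma sign_risk_nonneg: "0 \<le> sign_risk n p \<sigma> \<Omega> est \<beta> i"
  unfolding sign_risk_def by (intro integral_nonneg_AE) (simp add: sign_error_bounds)

lemma sign_risk_le_1:
  assumes "est \<in> estimators n p" "i < p"
  shows "sign_risk n p \<sigma> \<Omega> est \<beta> i \<le> 1"
proof -
  interpret prob_space "noise_space n p" by (rule prob_space_noise_space)
  show ?thesis unfolding sign_risk_def
    by (rule integral_le_const[OF integrable_sign_error[OF assms]]) (simp add: sign_error_bounds)
qed

text \<open>Given \<open>W\<close> the response is Gaussian with mean X \<beta>, so the two-point
  bound applies with the random squared separation |X (\<beta>1 - \<beta>0)|^2 / \<sigma>^2. The n
  rows contribute equally and its mean is \<open>quad p \<Omega> (\<lambda>j. \<beta>1 j - \<beta>0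
  j) / \<sigma>\<^sup>2\<close>, whatever n is.\<close>

lemma sign_risk_two_point:
  assumes \<Omega>: "corr_matrix p \<Omega>" and est: "est \<in> estimators n p" and n: "0 < n" and i: "i < p"
    and sgn: "sgn (\<beta>0 i) \<noteq> sgn (\<beta>1 i)" and w: "0 \<le> w0" "0 \<le> w1" and \<sigma>: "0 < \<sigma>"
    and s: "0 \<le> s" "s \<le> 1" and \<delta>: "0 < \<delta>"
    and V: "(1 + \<delta>) * (quad p \<Omega> (\<lambda>j. \<beta>1 j - \<beta>0 j) / \<sigma>\<^sup>2) \<le> V" "2 * V \<le> K\<^sup>2" "0 < K"
    and m: "m \<le> w0 * exp (- s\<^sup>2 * V / 2)" "m \<le> w1 * exp (- (1 - s)\<^sup>2 * V / 2)" "0 \<le> m"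
  shows "m * (exp (- K) / 2) * (\<delta> / (1 + \<delta>)) \<le>
    w0 * sign_risk n p \<sigma> \<Omega> est \<beta>0 i + w1 * sign_risk n p \<sigma> \<Omega> est \<beta>1 i"
proof -
  let ?I = "{..<n} \<times> {..<p}"
  let ?W = "PiM ?I (\<lambda>_. std_normal_measure)" and ?Z = "PiM {..<n} (\<lambda>_. std_normal_measure)"
  interpret Z: prob_space ?Z by (rule prob_space_std_normal_product)
  define u where "u l = (\<Sum>j<p. sqrtm p \<Omega> j l * (\<beta>1 j - \<beta>0 j))" for l
  \<comment> \<open>The coefficients, as a linear form in the whole array \<open>W\<close>, of the
    k-th entry of X (\<beta>1 - \<beta>0) / \<sigma>; they vanish off row \<open>k\<close>.\<close>
  define c where "c k kl = (if fst kl = k then u (snd kl) / (sqrt (real n) * \<sigma>) else 0)" for k :: nat and kl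
  define q where "q = quad p \<Omega> (\<lambda>j. \<beta>1 j - \<beta>0 j) / \<sigma>\<^sup>2"
  define err where "err \<beta> = sign_error n p \<sigma> \<Omega> est \<beta> i" for \<beta>
  have qpos: "0 < q"
  proof -
    have "\<beta>1 i - \<beta>0 i \<noteq> 0" using sgn by auto
    hence "\<exists>i<p. \<beta>1 i - \<beta>0 i \<noteq> 0" using i by blast
    hence "0 < quad p \<Omega> (\<lambda>j. \<beta>1 j - \<beta>0 j)"
      using corr_matrix_def[THEN iffD1, OF \<Omega>, THEN conjunct2, THEN conjunct2, THEN spec,
          of "\<lambda>j. \<beta>1 j - \<beta>0 j"] by simp
    thus ?thesis using \<sigma> by (simp add: q_def)
  qed
  have sumc: "(\<Sum>k<n. \<Sum>l\<in>?I. (c k l)\<^sup>2) = q"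
  proof -
    have "(\<Sum>l\<in>?I. (c k l)\<^sup>2) = (\<Sum>l<p. (u l)\<^sup>2) / (real n * \<sigma>\<^sup>2)" if "k < n" for k
    proof -
      have "(\<Sum>l\<in>?I. (c k l)\<^sup>2) = (\<Sum>k'<n. \<Sum>l<p. (c k (k', l))\<^sup>2)"
        by (subst sum.cartesian_product) (simp add: case_prod_beta')
      also have "\<dots> = (\<Sum>k'<n. if k' = k then \<Sum>l<p. (c k (k, l))\<^sup>2 else 0)"
        by (intro sum.cong) (auto simp: c_def)
      also have "\<dots> = (\<Sum>l<p. (c k (k, l))\<^sup>2)" using that by simp
      finally show ?thesis using n
        by (simp add: c_def power_divide power_mult_distrib sum_divide_distrib)
    qed
    hence "(\<Sum>k<n. \<Sum>l\<in>?I. (c k l)\<^sup>2) = real n * ((\<Sum>l<p. (u l)\<^sup>2) / (real n * \<sigma>\<^sup>2))" by simp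
    also have "\<dots> = q" using n sum_sqrtm_squares[OF \<Omega>] by (simp add: q_def u_def)
    finally show ?thesis .
  qed
  have risk: "ennreal (w * sign_risk n p \<sigma> \<Omega> est \<beta> i) =
      (\<integral>\<^sup>+W. (\<integral>\<^sup>+z. ennreal (w * err \<beta> (W, z)) \<partial>?Z) \<partial>?W)"
    and meas[measurable]: "(\<lambda>W. \<integral>\<^sup>+z. ennreal (w * err \<beta> (W, z)) \<partial>?Z) \<in> borel_measurable ?W"
    if "0 \<le> w" for w \<beta>
  proof -
    have int: "integrable (noise_space n p) (\<lambda>\<omega>. w * err \<beta> \<omega>)"
      unfolding err_def by (intro integrable_mult_right integrable_sign_error est i)
    have m[measurable]: "(\<lambda>\<omega>. ennreal (w * err \<beta> \<omega>)) \<in> borel_measurable (?W \<Otimes>\<^sub>M ?Z)"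
      using borel_measurable_integrable[OF int] unfolding noise_space_def by measurable
    have "ennreal (w * sign_risk n p \<sigma> \<Omega> est \<beta> i) = ennreal (\<integral>\<omega>. w * err \<beta> \<omega> \<partial>noise_space n p)"
      by (simp add: sign_risk_def err_def)
    also have "\<dots> = (\<integral>\<^sup>+\<omega>. ennreal (w * err \<beta> \<omega>) \<partial>noise_space n p)"
      using that by (intro nn_integral_eq_integral[symmetric] int) (simp add: err_def sign_error_bounds)
    also have "\<dots> = (\<integral>\<^sup>+W. (\<integral>\<^sup>+z. ennreal (w * err \<beta> (W, z)) \<partial>?Z) \<partial>?W)"
      unfolding noise_space_def by (rule Z.nn_integral_fst[symmetric]) measurable
    finally show "ennreal (w * sign_risk n p \<sigma> \<Omega> est \<beta> i) =
      (\<integral>\<^sup>+W. (\<integral>\<^sup>+z. ennreal (w * err \<beta> (W, z)) \<partial>?Z) \<partial>?W)" .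
    show "(\<lambda>W. \<integral>\<^sup>+z. ennreal (w * err \<beta> (W, z)) \<partial>?Z) \<in> borel_measurable ?W"
      by (rule Z.borel_measurable_nn_integral_fst[OF m])
  qed
  have given_W: "ennreal (m * (exp (- K) / 2)) \<le>
      (\<integral>\<^sup>+z. ennreal (w0 * err \<beta>0 (W, z)) \<partial>?Z) + (\<integral>\<^sup>+z. ennreal (w1 * err \<beta>1 (W, z)) \<partial>?Z)"
    if W: "W \<in> space ?W" and Q: "(\<Sum>k<n. (\<Sum>l\<in>?I. c k l * W l)\<^sup>2) \<le> (1 + \<delta>) * q" for W
  proof -
    define X where "X = design n p \<Omega> W"
    define F where "F \<beta> y = (if sgn (est (X, y) i) \<noteq> sgn (\<beta> i) then 1 else 0 :: real)"
      for \<beta> :: "nat \<Rightarrow> real" and y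
    define mn where "mn \<beta> k = (\<Sum>j<p. X (k, j) * \<beta> j)" for \<beta> :: "nat \<Rightarrow> real" and k
    have X: "X \<in> space (PiM ?I (\<lambda>_. borel :: real measure))"
      unfolding X_def by (rule measurable_space[OF design_measurable W])
    have F_meas: "F \<beta> \<in> borel_measurable (PiM {..<n} (\<lambda>_. borel))" for \<beta>
    proof -
      have "(\<lambda>d. est d i) \<in> borel_measurable (data_space n p)"
        using est i by (auto simp: estimators_def)
      moreover have "(\<lambda>y. (X, y)) \<in> measurable (PiM {..<n} (\<lambda>_. borel)) (data_space n p)"
        unfolding data_space_def using X by (intro measurable_Pair1') auto
      ultimately have [measurable]: "(\<lambda>y. est (X, y) i) \<in> borel_measurable (PiM {..<n} (\<lambda>_. borel))"
        using measurable_compose by blast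
      have [measurable]: "(sgn :: real \<Rightarrow> real) \<in> borel_measurable borel"
        unfolding sgn_real_def[abs_def] by measurable
      show ?thesis unfolding F_def by measurable
    qed
    have err_F: "err \<beta> (W, z) = F \<beta> (\<lambda>k\<in>{..<n}. mn \<beta> k + \<sigma> * z k)" for \<beta> z
      by (simp add: err_def sign_error_def F_def response_def X_def mn_def Let_def)
    have "(mn \<beta>1 k - mn \<beta>0 k) / \<sigma> = (\<Sum>l\<in>?I. c k l * W l)" if k: "k < n" for k
    proof -
      have "mn \<beta>1 k - mn \<beta>0 k = (\<Sum>j<p. X (k, j) * (\<beta>1 j - \<beta>0 j))"
        by (simp add: mn_def sum_subtractf right_diff_distrib)
      also have "\<dots> = (\<Sum>j<p. \<Sum>l<p. W (k, l) * (sqrtm p \<Omega> j l * (\<beta>1 j - \<beta>0 j)) / sqrt (real n))"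
        using k by (intro sum.cong refl)
          (simp add: X_def design_def sum_distrib_right sum_divide_distrib mult.assoc)
      also have "\<dots> = (\<Sum>l<p. \<Sum>j<p. W (k, l) * (sqrtm p \<Omega> j l * (\<beta>1 j - \<beta>0 j)) / sqrt (real n))"
        by (rule sum.swap)
      also have "\<dots> = (\<Sum>l<p. W (k, l) * u l / sqrt (real n))"
        by (simp add: u_def sum_distrib_left sum_divide_distrib)
      finally have 1: "(mn \<beta>1 k - mn \<beta>0 k) / \<sigma> = (\<Sum>l<p. c k (k, l) * W (k, l))"
        by (simp add: c_def sum_divide_distrib mult_ac)
      have "(\<Sum>l\<in>?I. c k l * W l) = (\<Sum>k'<n. \<Sum>l<p. c k (k', l) * W (k', l))"
        by (subst sum.cartesian_product) (simp add: case_prod_beta')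
      also have "\<dots> = (\<Sum>k'<n. if k' = k then \<Sum>l<p. c k (k, l) * W (k, l) else 0)"
        by (intro sum.cong) (auto simp: c_def)
      also have "\<dots> = (\<Sum>l<p. c k (k, l) * W (k, l))" using k by simp
      finally show ?thesis using 1 by simp
    qed
    hence "(\<Sum>k<n. ((mn \<beta>1 k - mn \<beta>0 k) / \<sigma>)\<^sup>2) = (\<Sum>k<n. (\<Sum>l\<in>?I. c k l * W l)\<^sup>2)"
      by (intro sum.cong) auto
    hence bound: "(\<Sum>k<n. ((mn \<beta>1 k - mn \<beta>0 k) / \<sigma>)\<^sup>2) \<le> V" using Q V(1) by (simp add: q_def)
    show ?thesis unfolding err_F
      by (rule Gaussian_two_point[OF _ F_meas F_meas _ _ _ w \<sigma> s bound V(2,3) m])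
        (use sgn in \<open>auto simp: F_def\<close>)
  qed
  have "ennreal (m * (exp (- K) / 2) * (\<delta> / (1 + \<delta>))) = ennreal (m * (exp (- K) / 2)) * ennreal (\<delta> / (1 + \<delta>))"
    using m(3) \<delta> by (intro ennreal_mult) auto
  also have "\<dots> \<le> ennreal (m * (exp (- K) / 2)) *
      (\<integral>\<^sup>+W. (if (\<Sum>k<n. (\<Sum>l\<in>?I. c k l * W l)\<^sup>2) \<le> (1 + \<delta>) * q then 1 else 0) \<partial>?W)"
    by (intro mult_left_mono std_normal_Markov_quadratic sumc qpos \<delta>) auto
  also have "\<dots> = (\<integral>\<^sup>+W. ennreal (m * (exp (- K) / 2)) *
      (if (\<Sum>k<n. (\<Sum>l\<in>?I. c k l * W l)\<^sup>2) \<le> (1 + \<delta>) * q then 1 else 0) \<partial>?W)"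
    by (rule nn_integral_cmult[symmetric]) measurable
  \<comment> \<open>Designs with a larger separation are discarded: there the left integrand is
    0.\<close>
  also have "\<dots> \<le> (\<integral>\<^sup>+W. (\<integral>\<^sup>+z. ennreal (w0 * err \<beta>0 (W, z)) \<partial>?Z) +
      (\<integral>\<^sup>+z. ennreal (w1 * err \<beta>1 (W, z)) \<partial>?Z) \<partial>?W)"
    using given_W by (intro nn_integral_mono) auto
  also have "\<dots> = ennreal (w0 * sign_risk n p \<sigma> \<Omega> est \<beta>0 i) + ennreal (w1 * sign_risk n p \<sigma> \<Omega> est \<beta>1 i)"
    unfolding risk[OF w(1)] risk[OF w(2)] by (intro nn_integral_add meas w)
  also have "\<dots> = ennreal (w0 * sign_risk n p \<sigma> \<Omega> est \<beta>0 i + w1 * sign_risk n p \<sigma> \<Omega> est \<beta>1 i)"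
    using w by (intro ennreal_plus[symmetric]) (simp_all add: sign_risk_nonneg)
  finally show ?thesis using w by (subst (asm) ennreal_le_iff) (simp_all add: sign_risk_nonneg)
qed

section \<open>The Hamming risk as a finite sum over supports\<close>

lemma measure_Bernoulli_PiM_singleton:
  fixes \<epsilon> :: real
  assumes "finite U" "0 \<le> \<epsilon>" "\<epsilon> \<le> 1" "B \<subseteq> U"
  defines "M \<equiv> PiM U (\<lambda>_. measure_pmf (bernoulli_pmf \<epsilon>))"
  shows "{\<lambda>i\<in>U. i \<in> B} \<in> sets M"
    and "measure M {\<lambda>i\<in>U. i \<in> B} = \<epsilon> ^ card B * (1 - \<epsilon>) ^ card (U - B)"
proof -
  interpret product_sigma_finite "\<lambda>_. measure_pmf (bernoulli_pmf \<epsilon>)" by standard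
  \<comment> \<open>A single point of the product space is a box of singletons, so its mass is a
    product of Bernoulli masses.\<close>
  have eq: "{\<lambda>i\<in>U. i \<in> B} = Pi\<^sub>E U (\<lambda>i. {i \<in> B})"
    using PiE_singleton[of "\<lambda>i\<in>U. i \<in> B" U] by (simp cong: PiE_cong)
  show "{\<lambda>i\<in>U. i \<in> B} \<in> sets M"
    unfolding eq M_def using assms(1) by (intro sets_PiM_I_finite) auto
  have "emeasure M {\<lambda>i\<in>U. i \<in> B} = (\<Prod>i\<in>U. emeasure (measure_pmf (bernoulli_pmf \<epsilon>)) {i \<in> B})"
    unfolding eq M_def using assms(1) by (intro emeasure_PiM) auto
  also have "\<dots> = (\<Prod>i\<in>U. ennreal (if i \<in> B then \<epsilon> else 1 - \<epsilon>))"
    using assms by (intro prod.cong) (auto simp: emeasure_pmf_single)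
  also have "\<dots> = ennreal (\<Prod>i\<in>U. if i \<in> B then \<epsilon> else 1 - \<epsilon>)"
    using assms by (intro prod_ennreal) auto
  also have "(\<Prod>i\<in>U. if i \<in> B then \<epsilon> else 1 - \<epsilon>) = \<epsilon> ^ card B * (1 - \<epsilon>) ^ card (U - B)"
  proof -
    have "U \<inter> {i. i \<in> B} = B" "U \<inter> - {i. i \<in> B} = U - B" using assms(4) by auto
    thus ?thesis using assms(1) by (simp add: prod.If_cases)
  qed
  finally have e: "emeasure M {\<lambda>i\<in>U. i \<in> B} = ennreal (\<epsilon> ^ card B * (1 - \<epsilon>) ^ card (U - B))" .
  have "0 \<le> \<epsilon> ^ card B * (1 - \<epsilon>) ^ card (U - B)" using assms(2,3) by simp
  thus "measure M {\<lambda>i\<in>U. i \<in> B} = \<epsilon> ^ card B * (1 - \<epsilon>) ^ card (U - B)"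
    unfolding measure_def e by (rule enn2real_ennreal)
qed

text \<open>\<open>b\<close> takes finitely many values, so the loss is a finite sum of an indicator
  in \<open>b\<close> times a function of the noise alone, and Fubini factorises each term.\<close>

lemma hamming_risk_eq_sum_sign_risk:
  fixes \<epsilon> :: real
  assumes \<epsilon>: "0 \<le> \<epsilon>" "\<epsilon> \<le> 1" and est: "est \<in> estimators n p"
    and \<mu>: "\<And>i. p \<le> i \<Longrightarrow> \<mu> i = 0"
  shows "hamming_risk \<epsilon> n p \<sigma> \<Omega> est \<mu> = (\<Sum>B\<in>Pow {..<p}. \<epsilon> ^ card B * (1 - \<epsilon>) ^ card ({..<p} - B) *
     (\<Sum>i<p. sign_risk n p \<sigma> \<Omega> est (\<lambda>i. if i \<in> B then \<mu> i else 0) i))"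
proof -
  let ?M = "PiM {..<p} (\<lambda>_. measure_pmf (bernoulli_pmf \<epsilon>))" and ?N = "noise_space n p"
  interpret M: prob_space ?M by (intro prob_space_PiM) unfold_locales
  interpret N: prob_space ?N by (rule prob_space_noise_space)
  interpret pair_sigma_finite ?M ?N ..
  interpret MN: prob_space "?M \<Otimes>\<^sub>M ?N" by (intro prob_space_pair M.prob_space_axioms N.prob_space_axioms)
  define bB where "bB B = (\<lambda>i\<in>{..<p}. i \<in> B)" for B
  define h where "h B \<omega> = (\<Sum>i<p. sign_error n p \<sigma> \<Omega> est (\<lambda>i. if i \<in> B then \<mu> i else 0) i \<omega>)" for B \<omega>
  have bB_sets[measurable]: "{bB B} \<in> sets ?M"
    and bB_measure: "measure ?M {bB B} = \<epsilon> ^ card B * (1 - \<epsilon>) ^ card ({..<p} - B)"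
    if "B \<in> Pow {..<p}" for B
    unfolding bB_def using measure_Bernoulli_PiM_singleton[of "{..<p}" \<epsilon> B] \<epsilon> that by auto
  have h_int: "integrable ?N (h B)" for B
    unfolding h_def by (intro Bochner_Integration.integrable_sum integrable_sign_error est) auto
  have h_bounds: "0 \<le> h B \<omega>" "h B \<omega> \<le> real p" for B \<omega>
  proof -
    show "0 \<le> h B \<omega>" unfolding h_def by (intro sum_nonneg sign_error_bounds)
    have "h B \<omega> \<le> (\<Sum>i<p. 1)" unfolding h_def by (intro sum_mono sign_error_bounds)
    thus "h B \<omega> \<le> real p" by simp
  qed
  have int: "integrable (?M \<Otimes>\<^sub>M ?N) (\<lambda>x. indicator {bB B} (fst x) * h B (snd x))"
    if B: "B \<in> Pow {..<p}" for B
  proof (rule MN.integrable_const_bound[where B = "real p"])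
    show "AE x in ?M \<Otimes>\<^sub>M ?N. norm (indicator {bB B} (fst x) * h B (snd x)) \<le> real p"
      by (intro AE_I2) (auto simp: indicator_def h_bounds abs_of_nonneg)
    have [measurable]: "h B \<in> borel_measurable ?N" using h_int by (rule borel_measurable_integrable)
    show "(\<lambda>x. indicator {bB B} (fst x) * h B (snd x)) \<in> borel_measurable (?M \<Otimes>\<^sub>M ?N)"
      using bB_sets[OF B] by measurable
  qed
  have decomp: "(case x of (b, W, z) \<Rightarrow> let X = design n p \<Omega> W; \<beta> = beta_of b \<mu> in
        hamming_loss p (est (X, response n p \<sigma> X \<beta> z)) \<beta>) =
      (\<Sum>B\<in>Pow {..<p}. indicator {bB B} (fst x) * h B (snd x))"
    if "x \<in> space (?M \<Otimes>\<^sub>M ?N)" for x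
  proof -
    obtain b W z where x: "x = (b, W, z)" by (cases x)
    define B where "B = {i. i < p \<and> b i}"
    have "b \<in> space ?M" using that unfolding x space_pair_measure by simp
    \<comment> \<open>Points of the product space are \<open>undefined\<close> outside the index
      set, so \<open>b\<close> can be recovered from its support \<open>B\<close>.\<close>
    hence b: "b \<in> extensional {..<p}" by (simp add: space_PiM PiE_def)
    have bB: "bB B = b"
    proof (rule ext)
      fix i show "bB B i = b i"
        using b by (cases "i < p") (simp_all add: bB_def B_def extensional_def)
    qed
    have bB': "B' = B" if "bB B' = b" "B' \<in> Pow {..<p}" for B'
    proof -
      have "i \<in> B' \<longleftrightarrow> b i" if "i < p" for i
        using that fun_cong[OF \<open>bB B' = b\<close>, of i] by (simp add: bB_def)
      thus ?thesis using \<open>B' \<in> Pow {..<p}\<close> unfolding B_def by blast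
    qed
    have ind: "indicator {bB B'} b = (if B' = B then 1 else 0 :: real)" if "B' \<in> Pow {..<p}" for B'
      using bB bB'[OF _ that] by (cases "bB B' = b") auto
    have "(\<Sum>B'\<in>Pow {..<p}. indicator {bB B'} (fst x) * h B' (snd x)) =
        (\<Sum>B'\<in>Pow {..<p}. if B' = B then h B (W, z) else 0)"
      by (intro sum.cong refl) (simp add: x ind)
    also have "\<dots> = h B (W, z)"
      by (subst sum.delta) (auto simp: B_def)
    also have "\<dots> = (case x of (b, W, z) \<Rightarrow> let X = design n p \<Omega> W; \<beta> = beta_of b \<mu> in
        hamming_loss p (est (X, response n p \<sigma> X \<beta> z)) \<beta>)"
    proof -
      \<comment> \<open>Beyond \<open>p\<close> the value of \<open>b\<close> is unspecified;
        \<open>\<mu>\<close> vanishes there, so both sides are 0.\<close>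
      have "(\<lambda>i. if i \<in> B then \<mu> i else 0) = beta_of b \<mu>"
        using \<mu> by (auto simp: beta_of_def B_def fun_eq_iff not_less)
      thus ?thesis by (simp add: h_def x sign_error_def hamming_loss_def Let_def)
    qed
    finally show ?thesis by simp
  qed
  have "hamming_risk \<epsilon> n p \<sigma> \<Omega> est \<mu> =
      integral\<^sup>L (?M \<Otimes>\<^sub>M ?N) (\<lambda>x. \<Sum>B\<in>Pow {..<p}. indicator {bB B} (fst x) * h B (snd x))"
    unfolding hamming_risk_def sample_space_def noise_space_def[symmetric]
    by (intro Bochner_Integration.integral_cong refl decomp)
  also have "\<dots> = (\<Sum>B\<in>Pow {..<p}. integral\<^sup>L (?M \<Otimes>\<^sub>M ?N) (\<lambda>x. indicator {bB B} (fst x) * h B (snd x)))"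
    by (intro Bochner_Integration.integral_sum int)
  also have "\<dots> = (\<Sum>B\<in>Pow {..<p}. \<epsilon> ^ card B * (1 - \<epsilon>) ^ card ({..<p} - B) *
     (\<Sum>i<p. sign_risk n p \<sigma> \<Omega> est (\<lambda>i. if i \<in> B then \<mu> i else 0) i))"
  proof (intro sum.cong refl)
    fix B assume B: "B \<in> Pow {..<p}"
    have "integral\<^sup>L (?M \<Otimes>\<^sub>M ?N) (\<lambda>x. indicator {bB B} (fst x) * h B (snd x)) =
        (\<integral>b. (\<integral>\<omega>. indicator {bB B} b * h B \<omega> \<partial>?N) \<partial>?M)"
      using integral_fst'[OF int[OF B]] by simp
    also have "\<dots> = (\<integral>b. indicator {bB B} b \<partial>?M) * integral\<^sup>L ?N (h B)" by simp
    also have "(\<integral>b. indicator {bB B} b \<partial>?M) = measure ?M {bB B}"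
      using bB_sets[OF B] sets.sets_into_space[OF bB_sets[OF B]] by (simp add: Int_absorb1)
    also have "integral\<^sup>L ?N (h B) = (\<Sum>i<p. sign_risk n p \<sigma> \<Omega> est (\<lambda>i. if i \<in> B then \<mu> i else 0) i)"
      unfolding h_def sign_risk_def
      by (intro Bochner_Integration.integral_sum integrable_sign_error est) auto
    finally show "integral\<^sup>L (?M \<Otimes>\<^sub>M ?N) (\<lambda>x. indicator {bB B} (fst x) * h B (snd x)) =
      \<epsilon> ^ card B * (1 - \<epsilon>) ^ card ({..<p} - B) *
      (\<Sum>i<p. sign_risk n p \<sigma> \<Omega> est (\<lambda>i. if i \<in> B then \<mu> i else 0) i)"
      using bB_measure[OF B] by simp
  qed
  finally show ?thesis .
qed

text \<open>Boundedness in \<open>\<mu>\<close>, without which the real-valued supremum in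
  \<open>Hamm_star\<close> could not be used as an upper bound of the risks.\<close>

lemma hamming_risk_le:
  assumes "0 \<le> \<epsilon>" "\<epsilon> \<le> 1" "est \<in> estimators n p" "\<And>i. p \<le> i \<Longrightarrow> \<mu> i = 0"
  shows "hamming_risk \<epsilon> n p \<sigma> \<Omega> est \<mu> \<le> real p"
proof -
  let ?w = "\<lambda>B. \<epsilon> ^ card B * (1 - \<epsilon>) ^ card ({..<p} - B)"
  have "hamming_risk \<epsilon> n p \<sigma> \<Omega> est \<mu> = (\<Sum>B\<in>Pow {..<p}. ?w B *
     (\<Sum>i<p. sign_risk n p \<sigma> \<Omega> est (\<lambda>i. if i \<in> B then \<mu> i else 0) i))"
    by (intro hamming_risk_eq_sum_sign_risk assms)
  also have "\<dots> \<le> (\<Sum>B\<in>Pow {..<p}. ?w B * (\<Sum>i<p. 1))"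
    using assms(1-3) by (intro sum_mono mult_left_mono sign_risk_le_1) auto
  also have "\<dots> = real p"
    using sum_Pow_Bernoulli[of "{..<p}" \<epsilon>] by (simp add: sum_distrib_right[symmetric])
  finally show ?thesis .
qed

text \<open>The block bound is applied for each estimator separately; since \<open>c\<close>, the
  blocks and the signals do not depend on the estimator, the bound passes to the infimum.\<close>

lemma Hamm_star_ge_sum_blocks:
  fixes D V0 V1 :: "'b \<Rightarrow> nat set"
  assumes \<theta>: "0 \<le> \<theta>" and p: "1 \<le> p" and a: "1 \<le> a" and \<tau>: "0 \<le> tau_of \<sigma> r p" and "finite I"
    and disj: "\<And>j k. j \<in> I \<Longrightarrow> k \<in> I \<Longrightarrow> j \<noteq> k \<Longrightarrow> D j \<inter> D k = {}"
    and D: "\<And>j. j \<in> I \<Longrightarrow> D j \<subseteq> {..<p} \<and> V0 j \<subseteq> D j \<and> V1 j \<subseteq> D j \<and> x j \<in> D j"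
    and \<mu>: "\<And>j. j \<in> I \<Longrightarrow> \<mu>0 j \<in> Theta p (tau_of \<sigma> r p) a \<and> \<mu>1 j \<in> Theta p (tau_of \<sigma> r p) a"
    and two_point: "\<And>j est \<beta>0 \<beta>1. j \<in> I \<Longrightarrow> est \<in> estimators (n_of \<kappa> p) p \<Longrightarrow>
      (\<And>i. i \<in> D j \<Longrightarrow> \<beta>0 i = (if i \<in> V0 j then \<mu>0 j i else 0)) \<Longrightarrow>
      (\<And>i. i \<in> D j \<Longrightarrow> \<beta>1 i = (if i \<in> V1 j then \<mu>1 j i else 0)) \<Longrightarrow>
      (\<And>i. i \<notin> D j \<Longrightarrow> \<beta>0 i = \<beta>1 i) \<Longrightarrow>
      c j \<le> eps_of \<theta> p ^ card (V0 j) * sign_risk (n_of \<kappa> p) p \<sigma> \<Omega> est \<beta>0 (x j) +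
            eps_of \<theta> p ^ card (V1 j) * sign_risk (n_of \<kappa> p) p \<sigma> \<Omega> est \<beta>1 (x j)"
  shows "(\<Sum>j\<in>I. (1 - eps_of \<theta> p) ^ card (D j) * c j / 2) \<le> Hamm_star \<sigma> \<theta> \<kappa> r a p \<Omega>"
  unfolding Hamm_star_def
proof (rule cINF_greatest)
  have "(\<lambda>_ _. 0) \<in> estimators (n_of \<kappa> p) p" by (simp add: estimators_def)
  thus "estimators (n_of \<kappa> p) p \<noteq> {}" by blast
next
  fix est assume est: "est \<in> estimators (n_of \<kappa> p) p"
  let ?\<epsilon> = "eps_of \<theta> p" and ?\<tau> = "tau_of \<sigma> r p" and ?n = "n_of \<kappa> p"
  have \<epsilon>: "0 \<le> ?\<epsilon>" "?\<epsilon> \<le> 1"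
    using p \<theta> powr_mono[of "- \<theta>" 0 "real p"] by (auto simp: eps_of_def)
  define S where "S = (SUP \<mu> \<in> Theta p ?\<tau> a. hamming_risk ?\<epsilon> ?n p \<sigma> \<Omega> est \<mu>)"
  \<comment> \<open>\<open>Theta\<close> is the product of these coordinate ranges, so a signal
    assembled blockwise from different members stays inside it.\<close>
  define A where "A i = (if i < p then {y. ?\<tau> \<le> \<bar>y\<bar> \<and> \<bar>y\<bar> \<le> a * ?\<tau>} else {0})" for i
  have Theta_A: "\<mu> \<in> Theta p ?\<tau> a \<longleftrightarrow> (\<forall>i. \<mu> i \<in> A i)" for \<mu>
    by (auto simp: Theta_def A_def not_less)
  have zero: "\<mu> i = 0" if "\<mu> \<in> Theta p ?\<tau> a" "p \<le> i" for \<mu> i using that by (auto simp: Theta_def)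
  have S: "hamming_risk ?\<epsilon> ?n p \<sigma> \<Omega> est \<mu> \<le> S" if "\<mu> \<in> Theta p ?\<tau> a" for \<mu>
    unfolding S_def
  proof (rule cSUP_upper[OF that])
    show "bdd_above ((\<lambda>\<mu>. hamming_risk ?\<epsilon> ?n p \<sigma> \<Omega> est \<mu>) ` Theta p ?\<tau> a)"
      by (intro bdd_aboveI2[where M = "real p"] hamming_risk_le \<epsilon> est zero)
  qed
  have "(\<Sum>j\<in>I. (1 - ?\<epsilon>) ^ card (D j) * c j / 2) \<le> S"
  proof (rule Bayes_risk_ge_sum_blocks[where U = "{..<p}" and A = A and D = D and ?V0.0 = V0
        and ?V1.0 = V1 and x = x and ?m0.0 = \<mu>0 and ?m1.0 = \<mu>1
        and base = "\<lambda>i. if i < p then ?\<tau> else 0" and \<Psi> = "sign_risk ?n p \<sigma> \<Omega> est"])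
    show "(if i < p then ?\<tau> else 0) \<in> A i" for i
      using \<tau> a mult_right_mono[of 1 a ?\<tau>] by (simp add: A_def)
    show "\<mu>0 j i \<in> A i \<and> \<mu>1 j i \<in> A i" if "j \<in> I" for i j
      using \<mu>[OF that] by (simp add: Theta_A)
    show "(\<Sum>B\<in>Pow {..<p}. ?\<epsilon> ^ card B * (1 - ?\<epsilon>) ^ card ({..<p} - B) *
         (\<Sum>i<p. sign_risk ?n p \<sigma> \<Omega> est (\<lambda>i. if i \<in> B then \<mu> i else 0) i)) \<le> S"
      if "\<And>i. \<mu> i \<in> A i" for \<mu>
    proof -
      have \<mu>T: "\<mu> \<in> Theta p ?\<tau> a" using that by (simp add: Theta_A)
      show ?thesis
        using S[OF \<mu>T] hamming_risk_eq_sum_sign_risk[of ?\<epsilon> est ?n p \<mu> \<sigma> \<Omega>] \<epsilon> est zero[OF \<mu>T]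
        by simp
    qed
  qed (use \<open>finite I\<close> \<epsilon> disj D sign_risk_nonneg two_point[OF _ est] in simp_all)
  thus "(\<Sum>j\<in>I. (1 - ?\<epsilon>) ^ card (D j) * c j / 2) \<le>
    (SUP \<mu> \<in> Theta p ?\<tau> a. hamming_risk ?\<epsilon> ?n p \<sigma> \<Omega> est \<mu>)"
    by (simp add: S_def)
qed

section \<open>The exponents\<close>

text \<open>Rids \<open>eta\<close> of square roots. At x = 0 the quotient is 0 by the convention
  for division, which agrees with the branch x \<le> k.\<close>

lemma power2_max_sqrt_diff:
  fixes x k :: real
  assumes "0 \<le> x" "0 \<le> k"
  shows "(max 0 (sqrt x - k / sqrt x))\<^sup>2 = (if x \<le> k then 0 else (x - k)\<^sup>2 / x)"
proof (cases "x = 0")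
  case False
  hence x: "0 < x" using assms by simp
  have eq: "sqrt x - k / sqrt x = (x - k) / sqrt x" using x by (simp add: field_simps)
  show ?thesis
  proof (cases "x \<le> k")
    case True
    hence "(x - k) / sqrt x \<le> 0" using x by (simp add: divide_nonpos_pos)
    thus ?thesis using True by (simp add: eq)
  next
    case False
    hence "0 \<le> (x - k) / sqrt x" using x by simp
    thus ?thesis using False x by (simp add: eq power_divide)
  qed
qed (use assms in auto)

text \<open>For x > k the function is x - 2 k + k^2 / x, with slope 1 - k^2 / x^2 \<le> 1. An
  enlarged separation therefore raises the exponent by no more than the enlargement.\<close>

lemma power2_max_sqrt_diff_Lipschitz:
  fixes x y k :: real
  assumes "0 \<le> x" "0 \<le> k" "x \<le> y"
  shows "(max 0 (sqrt y - k / sqrt y))\<^sup>2 \<le> (max 0 (sqrt x - k / sqrt x))\<^sup>2 + (y - x)"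
proof -
  have y: "0 \<le> y" using assms by simp
  consider "y \<le> k" | "k < y" "x \<le> k" | "k < x" by linarith
  thus ?thesis
  proof cases
    case 2
    have "(y - k)\<^sup>2 \<le> (y - x) * y"
      unfolding power2_eq_square using 2 assms by (intro mult_mono) auto
    hence "(y - k)\<^sup>2 / y \<le> y - x" using 2 assms(2) by (simp add: divide_le_eq)
    thus ?thesis using 2 by (simp add: power2_max_sqrt_diff[OF y assms(2)] power2_max_sqrt_diff[OF assms(1,2)])
  next
    case 3
    have "z - 2 * k + k\<^sup>2 / z = (z - k)\<^sup>2 / z" if "0 < z" for z
      using that by (simp add: field_simps power2_eq_square)
    moreover have "k\<^sup>2 / y \<le> k\<^sup>2 / x" using 3 assms by (intro divide_left_mono) auto
    ultimately have "(y - k)\<^sup>2 / y \<le> (x - k)\<^sup>2 / x + (y - x)"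
      using 3 assms by (smt (verit))
    thus ?thesis using 3 assms(3)
      by (simp add: power2_max_sqrt_diff[OF y assms(2)] power2_max_sqrt_diff[OF assms(1,2)])
  qed (use assms y in \<open>simp add: power2_max_sqrt_diff\<close>)
qed

text \<open>The converse control: a bound on \<open>eta\<close> bounds the separation, by dropping
  k^2 / x from x - 2 k + k^2 / x.\<close>

lemma le_power2_max_sqrt_diff:
  fixes x k :: real
  assumes "0 \<le> x" "0 \<le> k"
  shows "x \<le> (max 0 (sqrt x - k / sqrt x))\<^sup>2 + 2 * k"
proof (cases "x \<le> k")
  case False
  hence "x - 2 * k \<le> (x - k)\<^sup>2 / x" using assms by (simp add: field_simps power2_eq_square)
  thus ?thesis using False by (simp add: power2_max_sqrt_diff[OF assms])
qed (use assms in \<open>simp add: power2_max_sqrt_diff\<close>)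

text \<open>The witness s is the Chernoff point, where the two weighted error exponents agree (clipped to
  an endpoint when the prior odds dominate).\<close>

lemma exponent_balance:
  fixes v0 v1 A :: real
  assumes "0 \<le> A"
  defines "E \<equiv> max v0 v1 + (max 0 (sqrt A - \<bar>v1 - v0\<bar> / sqrt A))\<^sup>2 / 4"
  shows "\<exists>s\<ge>0. s \<le> 1 \<and> v0 + s\<^sup>2 * A \<le> E \<and> v1 + (1 - s)\<^sup>2 * A \<le> E"
proof -
  have E: "E = max v0 v1 + (if A \<le> \<bar>v1 - v0\<bar> then 0 else (A - \<bar>v1 - v0\<bar>)\<^sup>2 / A) / 4"
    unfolding E_def using assms(1) by (simp add: power2_max_sqrt_diff)
  consider "A \<le> v1 - v0" | "A \<le> v0 - v1" | "\<bar>v1 - v0\<bar> < A" by linarith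
  thus ?thesis
  proof cases
    case 1
    thus ?thesis unfolding E by (intro exI[of _ 1]) (use assms(1) in auto)
  next
    case 2
    thus ?thesis unfolding E by (intro exI[of _ 0]) (use assms(1) in auto)
  next
    case 3
    hence A: "0 < A" by linarith
    \<comment> \<open>In units of \<open>A\<close>, the equation v0 + s^2 A = v1 + (1 - s)^2 A has
      the solution s = (1 + t) / 2, which lies in [0, 1] because |t| < 1.\<close>
    define t where "t = (v1 - v0) / A"
    have t: "v1 = v0 + t * A" "\<bar>t\<bar> < 1" using 3 A by (auto simp: t_def abs_divide)
    have Et: "E = max v0 v1 + (1 - \<bar>t\<bar>)\<^sup>2 * A / 4"
    proof -
      have "\<bar>v1 - v0\<bar> = \<bar>t\<bar> * A" using t(1) A by (simp add: abs_mult)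
      hence "(A - \<bar>v1 - v0\<bar>)\<^sup>2 / A = (1 - \<bar>t\<bar>)\<^sup>2 * A"
        using A by (simp add: power2_eq_square field_simps)
      thus ?thesis using 3 by (simp add: E)
    qed
    have s0: "((1 + t) / 2)\<^sup>2 * A = (1 - t)\<^sup>2 * A / 4 + t * A"
      and s1: "(1 - (1 + t) / 2)\<^sup>2 * A = (1 - t)\<^sup>2 * A / 4"
      and s2: "(1 + t)\<^sup>2 * A / 4 = (1 - t)\<^sup>2 * A / 4 + t * A"
      by (simp_all add: power2_eq_square field_simps)
    have sign: "0 \<le> t * A \<longleftrightarrow> 0 \<le> t" using A by (simp add: zero_le_mult_iff)
    have "v0 + ((1 + t) / 2)\<^sup>2 * A \<le> E \<and> v1 + (1 - (1 + t) / 2)\<^sup>2 * A \<le> E"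
      unfolding s0 s1 Et t(1) using s2 sign by (cases "0 \<le> t") (auto simp: abs_if max_def)
    thus ?thesis using t(2) by (intro exI[of _ "(1 + t) / 2"]) auto
  qed
qed

section \<open>The least squared separation of a pair of supports\<close>

lemma quad_nonneg:
  assumes "corr_matrix p \<Omega>"
  shows "0 \<le> quad p \<Omega> x"
proof (cases "\<exists>i<p. x i \<noteq> 0")
  case True
  have "(\<exists>i<p. x i \<noteq> 0) \<longrightarrow> 0 < quad p \<Omega> x"
    using corr_matrix_def[THEN iffD1, OF assms] by simp
  thus ?thesis using True by simp
next
  case False
  thus ?thesis by (simp add: quad_def)
qed

lemma quad_diff_commute: "quad p \<Omega> (\<lambda>i. x i - y i) = quad p \<Omega> (\<lambda>i. y i - x i)"
  unfolding quad_def by (intro sum.cong refl) (simp add: algebra_simps)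

definition alpha_values where
  "alpha_values p \<tau> a \<Omega> V0 V1 = {quad p \<Omega> (\<lambda>i. \<theta>0 i - \<theta>1 i) / \<tau>\<^sup>2 | \<theta>0 \<theta>1.
            \<theta>0 \<in> B_set p \<tau> a V0 \<and> \<theta>1 \<in> B_set p \<tau> a V1 \<and> (\<lambda>i. sgn (\<theta>0 i)) \<noteq> (\<lambda>i. sgn (\<theta>1 i))}"

lemma alpha_star_eq: "alpha_star p \<tau> a \<Omega> V0 V1 = Inf (alpha_values p \<tau> a \<Omega> V0 V1)"
  by (simp add: alpha_star_def alpha_values_def)

lemma alpha_values_bdd_below:
  assumes "corr_matrix p \<Omega>"
  shows "bdd_below (alpha_values p \<tau> a \<Omega> V0 V1)" "\<And>x. x \<in> alpha_values p \<tau> a \<Omega> V0 V1 \<Longrightarrow> 0 \<le> x"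
proof -
  show *: "\<And>x. x \<in> alpha_values p \<tau> a \<Omega> V0 V1 \<Longrightarrow> 0 \<le> x"
    unfolding alpha_values_def by (auto simp: quad_nonneg[OF assms])
  show "bdd_below (alpha_values p \<tau> a \<Omega> V0 V1)" by (rule bdd_belowI[of _ 0]) (rule *)
qed

lemma const_in_Theta:
  assumes "0 \<le> \<tau>" "1 \<le> a" "\<bar>c\<bar> = \<tau>"
  shows "(\<lambda>i. if i < p then c else 0) \<in> Theta p \<tau> a"
  using assms mult_right_mono[of 1 a \<tau>] by (simp add: Theta_def)

text \<open>The constant signals \<tau> on \<open>V0\<close> and - \<tau> on \<open>V1\<close>
  differ in sign at \<open>j\<close> even when \<open>j\<close> lies in both sets, so the case V0 =
  V1 is covered.\<close>

lemma alpha_values_nonempty: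
  assumes "0 < \<tau>" "1 \<le> a" "V0 \<subseteq> {..<p}" "V1 \<subseteq> {..<p}" "j \<in> V0 \<union> V1"
  shows "alpha_values p \<tau> a \<Omega> V0 V1 \<noteq> {}"
proof -
  define \<theta> where "\<theta> c V i = (if i \<in> V then if i < p then c else 0 else 0 :: real)" for c :: real and V and i :: nat
  have mem: "\<theta> c V \<in> B_set p \<tau> a V" if "\<bar>c\<bar> = \<tau>" for c V
    unfolding B_set_def \<theta>_def[abs_def] using const_in_Theta[of \<tau> a c p] assms(1,2) that by auto
  have "j < p" using assms(3-5) by auto
  hence "sgn (\<theta> \<tau> V0 j) \<noteq> sgn (\<theta> (- \<tau>) V1 j)" using assms(1,5) by (auto simp: \<theta>_def)
  hence "(\<lambda>i. sgn (\<theta> \<tau> V0 i)) \<noteq> (\<lambda>i. sgn (\<theta> (- \<tau>) V1 i))" by (auto dest: fun_cong)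
  moreover have mem': "\<theta> \<tau> V0 \<in> B_set p \<tau> a V0" "\<theta> (- \<tau>) V1 \<in> B_set p \<tau> a V1"
    using mem assms(1) by simp_all
  ultimately have "quad p \<Omega> (\<lambda>i. \<theta> \<tau> V0 i - \<theta> (- \<tau>) V1 i) / \<tau>\<^sup>2 \<in> alpha_values p \<tau> a \<Omega> V0 V1"
    unfolding alpha_values_def using mem' by blast
  thus ?thesis by blast
qed

lemma alpha_star_nonneg:
  assumes "corr_matrix p \<Omega>" "0 < \<tau>" "1 \<le> a" "V0 \<subseteq> {..<p}" "V1 \<subseteq> {..<p}" "j \<in> V0 \<union> V1"
  shows "0 \<le> alpha_star p \<tau> a \<Omega> V0 V1"
  unfolding alpha_star_eq
  by (intro cInf_greatest alpha_values_nonempty[OF assms(2-6)] alpha_values_bdd_below(2)[OF assms(1)])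

text \<open>One signal of size \<tau> at \<open>j\<close> against none has separation \<tau>^2, by
  the unit diagonal.\<close>

lemma alpha_star_singleton_le_1:
  assumes "corr_matrix p \<Omega>" "0 < \<tau>" "1 \<le> a" "j < p"
  shows "alpha_star p \<tau> a \<Omega> {j} {} \<le> 1"
proof -
  define \<theta> where "\<theta> V i = (if i \<in> V then if i < p then \<tau> else 0 else 0 :: real)" for V and i :: nat
  have mem: "\<theta> V \<in> B_set p \<tau> a V" for V
    unfolding B_set_def \<theta>_def[abs_def] using const_in_Theta[of \<tau> a \<tau> p] assms(2,3) by auto
  have "sgn (\<theta> {j} j) \<noteq> sgn (\<theta> {} j)" using assms by (auto simp: \<theta>_def)
  hence "(\<lambda>i. sgn (\<theta> {j} i)) \<noteq> (\<lambda>i. sgn (\<theta> {} i))" by (auto dest: fun_cong)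
  hence in_values: "quad p \<Omega> (\<lambda>i. \<theta> {j} i - \<theta> {} i) / \<tau>\<^sup>2 \<in> alpha_values p \<tau> a \<Omega> {j} {}"
    unfolding alpha_values_def using mem[of "{j}"] mem[of "{}"] by blast
  have e: "\<theta> {j} i - \<theta> {} i = (if i = j then \<tau> else 0)" for i using assms(4) by (auto simp: \<theta>_def)
  have "quad p \<Omega> (\<lambda>i. \<theta> {j} i - \<theta> {} i) = (\<Sum>i<p. \<Sum>k<p. if i = j then if k = j then \<tau> * \<Omega> i k * \<tau> else 0 else 0)"
    unfolding quad_def e by (intro sum.cong refl) auto
  also have "\<dots> = (\<Sum>i<p. if i = j then \<Sum>k<p. if k = j then \<tau> * \<Omega> i k * \<tau> else 0 else 0)"
    by (intro sum.cong refl) auto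
  also have "\<dots> = \<tau> * \<Omega> j j * \<tau>" using assms(4) by simp
  also have "\<dots> = \<tau>\<^sup>2" using assms(1,4) by (simp add: corr_matrix_def power2_eq_square)
  finally have "1 \<in> alpha_values p \<tau> a \<Omega> {j} {}" using in_values assms(2) by simp
  thus ?thesis unfolding alpha_star_eq by (rule cInf_lower) (rule alpha_values_bdd_below[OF assms(1)])
qed

text \<open>An almost optimal pair replaces a minimiser, so no compactness argument is made; the
  slack \<delta> joins the other losses in the exponent.\<close>

lemma alpha_star_approx:
  assumes "corr_matrix p \<Omega>" "0 < \<tau>" "1 \<le> a" "V0 \<subseteq> {..<p}" "V1 \<subseteq> {..<p}" "j \<in> V0 \<union> V1" "0 < \<delta>"
  obtains \<mu>0 \<mu>1 \<alpha> i where "\<mu>0 \<in> Theta p \<tau> a" "\<mu>1 \<in> Theta p \<tau> a" "i \<in> V0 \<union> V1"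
    "sgn (if i \<in> V0 then \<mu>0 i else 0) \<noteq> sgn (if i \<in> V1 then \<mu>1 i else 0)"
    "quad p \<Omega> (\<lambda>i. (if i \<in> V1 then \<mu>1 i else 0) - (if i \<in> V0 then \<mu>0 i else 0)) = \<alpha> * \<tau>\<^sup>2"
    "alpha_star p \<tau> a \<Omega> V0 V1 \<le> \<alpha>" "\<alpha> \<le> alpha_star p \<tau> a \<Omega> V0 V1 + \<delta>"
proof -
  have "alpha_star p \<tau> a \<Omega> V0 V1 < alpha_star p \<tau> a \<Omega> V0 V1 + \<delta>" using assms by simp
  then obtain \<alpha> where \<alpha>: "\<alpha> \<in> alpha_values p \<tau> a \<Omega> V0 V1" "\<alpha> < alpha_star p \<tau> a \<Omega> V0 V1 + \<delta>"
    unfolding alpha_star_eq using alpha_values_bdd_below(1)[OF assms(1)] alpha_values_nonempty[OF assms(2-6)]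
    by (subst (asm) cInf_less_iff) auto
  from \<alpha>(1) obtain \<mu>0 \<mu>1 where \<mu>: "\<mu>0 \<in> Theta p \<tau> a" "\<mu>1 \<in> Theta p \<tau> a"
    and ne: "(\<lambda>i. sgn (if i \<in> V0 then \<mu>0 i else 0)) \<noteq> (\<lambda>i. sgn (if i \<in> V1 then \<mu>1 i else 0))"
    and eq: "\<alpha> = quad p \<Omega> (\<lambda>i. (if i \<in> V0 then \<mu>0 i else 0) - (if i \<in> V1 then \<mu>1 i else 0)) / \<tau>\<^sup>2"
    unfolding alpha_values_def B_set_def by blast
  from ne obtain i where i: "sgn (if i \<in> V0 then \<mu>0 i else 0) \<noteq> sgn (if i \<in> V1 then \<mu>1 i else 0)"
    by (auto simp: fun_eq_iff)
  hence iV: "i \<in> V0 \<union> V1" by (auto split: if_splits)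
  show thesis
  proof (rule that[OF \<mu> iV i])
    show "quad p \<Omega> (\<lambda>i. (if i \<in> V1 then \<mu>1 i else 0) - (if i \<in> V0 then \<mu>0 i else 0)) = \<alpha> * \<tau>\<^sup>2"
      using eq assms(2) by (subst quad_diff_commute) simp
    show "alpha_star p \<tau> a \<Omega> V0 V1 \<le> \<alpha>"
      unfolding alpha_star_eq by (rule cInf_lower[OF \<alpha>(1)]) (rule alpha_values_bdd_below[OF assms(1)])
  qed (use \<alpha>(2) in simp)
qed

section \<open>The exponent of a coordinate and its minimising pair\<close>

lemma finite_pairs_for: "finite (pairs_for p j)"
  by (rule finite_subset[of _ "Pow {..<p} \<times> Pow {..<p}"]) (auto simp: pairs_for_def)

text \<open>The pair \<open>({j}, {})\<close>, an isolated signal against nothing, has exponent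
  \<theta> if x \<le> \<theta> and (x + \<theta>)^2 / (4 x) otherwise, with x \<le> r. The bound is
  the value of the latter at x = r.\<close>

lemma rho_star_le:
  assumes "corr_matrix p \<Omega>" "0 < tau_of \<sigma> r p" "1 \<le> a" "j < p" "0 < \<theta>" "0 < r"
  shows "rho_star \<sigma> \<theta> r a p \<Omega> j \<le> (\<theta> + r)\<^sup>2 / (4 * r)"
proof -
  let ?\<tau> = "tau_of \<sigma> r p"
  define x where "x = alpha_star p ?\<tau> a \<Omega> {j} {} * r"
  have "0 \<le> alpha_star p ?\<tau> a \<Omega> {j} {}"
    by (rule alpha_star_nonneg[OF assms(1-3), where j = j]) (use assms in auto)
  hence x: "0 \<le> x" "x \<le> r"
    using alpha_star_singleton_le_1[OF assms(1-4)] assms(6) by (auto simp: x_def)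
  have "({j}, {}) \<in> pairs_for p j" using assms(4) by (auto simp: pairs_for_def)
  hence "rho_star \<sigma> \<theta> r a p \<Omega> j \<le> eta p \<theta> r ?\<tau> a \<Omega> {j} {}"
    unfolding rho_star_def using finite_pairs_for by (intro Min_le) force+
  also have "\<dots> = \<theta> + 1 / 4 * (max 0 (sqrt x - \<theta> / sqrt x))\<^sup>2"
    by (simp add: eta_def Let_def x_def)
  also have "\<dots> = \<theta> + (if x \<le> \<theta> then 0 else (x - \<theta>)\<^sup>2 / x) / 4"
    using x assms(5) by (simp add: power2_max_sqrt_diff)
  also have "\<dots> \<le> (\<theta> + r)\<^sup>2 / (4 * r)"
  proof (cases "x \<le> \<theta>")
    case True
    have "0 \<le> (\<theta> - r)\<^sup>2" by simp
    hence "\<theta> \<le> (\<theta> + r)\<^sup>2 / (4 * r)" using assms(6) by (simp add: field_simps power2_eq_square)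
    thus ?thesis using True by simp
  next
    case False
    hence xp: "\<theta> < x" "0 < x" using assms(5) by auto
    \<comment> \<open>Monotonicity of x + 2 \<theta> + \<theta>^2 / x on x \<ge> \<theta>: after
      clearing denominators the comparison with r comes down to this product.\<close>
    have "\<theta> * \<theta> \<le> x * r" using xp x assms(5) by (intro mult_mono) auto
    hence "\<theta> * \<theta> * (r - x) \<le> x * r * (r - x)" using x by (intro mult_right_mono) auto
    hence "(x + \<theta>)\<^sup>2 / x \<le> (\<theta> + r)\<^sup>2 / r"
      using xp assms(6) by (simp add: field_simps power2_eq_square)
    moreover have "\<theta> + (x - \<theta>)\<^sup>2 / x / 4 = (x + \<theta>)\<^sup>2 / x / 4"
      using xp by (simp add: field_simps power2_eq_square)
    ultimately show ?thesis using False by simp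
  qed
  finally show ?thesis .
qed

text \<open>The two separate minima form a minimising pair because \<open>l1\<close> is sought only
  among minimisers whose first list is already \<open>l0\<close>.\<close>

lemma golf_pair_minimizer:
  assumes "j < p" "golf_pair \<sigma> \<theta> r a p \<Omega> j = (V0, V1)"
  shows "(V0, V1) \<in> pairs_for p j"
    and "eta p \<theta> r (tau_of \<sigma> r p) a \<Omega> V0 V1 = rho_star \<sigma> \<theta> r a p \<Omega> j"
proof -
  let ?e = "\<lambda>(V0, V1). eta p \<theta> r (tau_of \<sigma> r p) a \<Omega> V0 V1"
  define Mins where "Mins = {(V0, V1) \<in> pairs_for p j. ?e (V0, V1) = rho_star \<sigma> \<theta> r a p \<Omega> j}"
  define l0 where "l0 = Min ((\<lambda>(V0, V1). sorted_list_of_set V0) ` Mins)"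
  define M1 where "M1 = {(V0, V1) \<in> Mins. sorted_list_of_set V0 = l0}"
  define l1 where "l1 = Min ((\<lambda>(V0, V1). sorted_list_of_set V1) ` M1)"
  have "({j}, {}) \<in> pairs_for p j" using assms(1) by (auto simp: pairs_for_def)
  hence "rho_star \<sigma> \<theta> r a p \<Omega> j \<in> ?e ` pairs_for p j"
    unfolding rho_star_def using finite_pairs_for by (intro Min_in) auto
  then obtain W0 W1 where "(W0, W1) \<in> pairs_for p j" "rho_star \<sigma> \<theta> r a p \<Omega> j = ?e (W0, W1)"
    by auto
  hence "(W0, W1) \<in> Mins" by (simp add: Mins_def)
  hence ne: "Mins \<noteq> {}" by blast
  have "Mins \<subseteq> pairs_for p j" by (auto simp: Mins_def)
  hence fin: "finite Mins" using finite_pairs_for finite_subset by blast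
  have "l0 \<in> (\<lambda>(V0, V1). sorted_list_of_set V0) ` Mins"
    unfolding l0_def using fin ne by (intro Min_in) auto
  hence ne1: "M1 \<noteq> {}" by (auto simp: M1_def)
  have fin1: "finite M1" unfolding M1_def using fin by (rule rev_finite_subset) auto
  have "l1 \<in> (\<lambda>(V0, V1). sorted_list_of_set V1) ` M1"
    unfolding l1_def using fin1 ne1 by (intro Min_in) auto
  then obtain W0 W1 where W: "(W0, W1) \<in> Mins" "sorted_list_of_set W0 = l0" "sorted_list_of_set W1 = l1"
    by (auto simp: M1_def)
  have "W0 \<subseteq> {..<p}" "W1 \<subseteq> {..<p}" using W(1) by (auto simp: Mins_def pairs_for_def)
  hence "finite W0" "finite W1" using finite_subset by blast+
  hence "set l0 = W0" "set l1 = W1" using W(2,3) by auto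
  moreover have "golf_pair \<sigma> \<theta> r a p \<Omega> j = (set l0, set l1)"
    unfolding golf_pair_def Let_def l1_def M1_def l0_def Mins_def by simp
  ultimately have "(V0, V1) \<in> Mins" using W(1) assms(2) by simp
  thus "(V0, V1) \<in> pairs_for p j"
    and "eta p \<theta> r (tau_of \<sigma> r p) a \<Omega> V0 V1 = rho_star \<sigma> \<theta> r a p \<Omega> j"
    by (auto simp: Mins_def)
qed

section \<open>The lower bound\<close>

text \<open>The loss \<delta> (6 M + 2 r + 1) has two sources: 6 M + 2 r pays for the slack in
  \<open>alpha_star\<close> and for the inflation 1 + \<delta> of the separation, and 1 pays for exp
  (- K). The signals and the coordinate are fixed before the estimator, and the coefficients off the
  supports are free as long as they agree.\<close>

lemma least_favorable_pair_two_point: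
  fixes \<theta> r a \<sigma> \<delta> :: real and \<Omega> :: "nat \<Rightarrow> nat \<Rightarrow> real" and p :: nat and V0 V1 :: "nat set"
  defines "M \<equiv> (\<theta> + r)\<^sup>2 / (4 * r)"
  defines "\<eta> \<equiv> eta p \<theta> r (tau_of \<sigma> r p) a \<Omega> V0 V1"
  assumes \<Omega>: "corr_matrix p \<Omega>" and pos: "0 < \<theta>" "0 < r" "1 \<le> a" "0 < \<sigma>" and \<delta>: "0 < \<delta>" "\<delta> \<le> 1"
    and p: "2 \<le> p" and V: "(V0, V1) \<in> pairs_for p j" and \<eta>: "\<eta> \<le> M"
    and K: "2 * sqrt ((12 * M + 2 * r) * ln (real p)) \<le> \<delta> * ln (real p)"
  shows "\<exists>\<mu>0\<in>Theta p (tau_of \<sigma> r p) a. \<exists>\<mu>1\<in>Theta p (tau_of \<sigma> r p) a. \<exists>i\<in>V0 \<union> V1.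
    \<forall>est\<in>estimators (n_of \<kappa> p) p. \<forall>\<beta>0 \<beta>1.
      (\<forall>i\<in>V0 \<union> V1. \<beta>0 i = (if i \<in> V0 then \<mu>0 i else 0)) \<longrightarrow>
      (\<forall>i\<in>V0 \<union> V1. \<beta>1 i = (if i \<in> V1 then \<mu>1 i else 0)) \<longrightarrow>
      (\<forall>i. i \<notin> V0 \<union> V1 \<longrightarrow> \<beta>0 i = \<beta>1 i) \<longrightarrow>
      \<delta> / 4 * real p powr (- \<eta> - \<delta> * (6 * M + 2 * r + 1)) \<le>
        eps_of \<theta> p ^ card V0 * sign_risk (n_of \<kappa> p) p \<sigma> \<Omega> est \<beta>0 i +
        eps_of \<theta> p ^ card V1 * sign_risk (n_of \<kappa> p) p \<sigma> \<Omega> est \<beta>1 i"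
proof -
  let ?\<tau> = "tau_of \<sigma> r p" and ?\<epsilon> = "eps_of \<theta> p"
  define l where "l = ln (real p)"
  have l: "0 < l" using p by (simp add: l_def)
  have powr_l: "real p powr x = exp (x * l)" for x using p by (simp add: powr_def l_def)
  have \<tau>2: "?\<tau>\<^sup>2 = \<sigma>\<^sup>2 * (2 * r * l)" using l pos by (simp add: tau_of_def power_mult_distrib l_def)
  have \<tau>: "0 < ?\<tau>" using l pos by (simp add: tau_of_def l_def)
  have M: "0 < M" using pos by (simp add: M_def)
  have Vs: "V0 \<subseteq> {..<p}" "V1 \<subseteq> {..<p}" "j \<in> V0 \<union> V1" using V by (auto simp: pairs_for_def)
  define x where "x = alpha_star p ?\<tau> a \<Omega> V0 V1 * r"
  define v0 where "v0 = real (card V0) * \<theta>"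
  define v1 where "v1 = real (card V1) * \<theta>"
  define h where "h y = (max 0 (sqrt y - \<bar>v1 - v0\<bar> / sqrt y))\<^sup>2" for y
  have x: "0 \<le> x" using alpha_star_nonneg[OF \<Omega> \<tau> pos(3) Vs] pos by (simp add: x_def)
  have dv: "\<bar>v1 - v0\<bar> = \<bar>real (card V1) - real (card V0)\<bar> * \<theta>"
    using pos by (simp add: v0_def v1_def abs_mult flip: left_diff_distrib)
  have maxv: "real (max (card V0) (card V1)) * \<theta> = max v0 v1"
    using pos by (simp add: v0_def v1_def max_mult_distrib_right of_nat_max)
  have \<eta>_eq: "\<eta> = max v0 v1 + h x / 4"
    by (simp add: \<eta>_def eta_def Let_def h_def dv maxv x_def)
  have v_nonneg: "0 \<le> v0" "0 \<le> v1" using pos by (auto simp: v0_def v1_def)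
  have h0: "0 \<le> h y" for y by (simp add: h_def)
  have "max v0 v1 \<le> M" "h x \<le> 4 * (M - max v0 v1)" using \<eta> h0[of x] by (auto simp: \<eta>_eq)
  moreover have "x \<le> h x + 2 * \<bar>v1 - v0\<bar>" unfolding h_def using x by (intro le_power2_max_sqrt_diff) auto
  \<comment> \<open>\<open>h x\<close> is at most 4 M, and |v1 - v0| is at most the larger of v0 and
    v1, hence at most M.\<close>
  ultimately have x_le: "x \<le> 6 * M" using v_nonneg by (smt (verit))
  obtain \<mu>0 \<mu>1 \<alpha> i where \<mu>: "\<mu>0 \<in> Theta p ?\<tau> a" "\<mu>1 \<in> Theta p ?\<tau> a" and i: "i \<in> V0 \<union> V1"
    and sgn: "sgn (if i \<in> V0 then \<mu>0 i else 0) \<noteq> sgn (if i \<in> V1 then \<mu>1 i else 0)"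
    and quad: "quad p \<Omega> (\<lambda>i. (if i \<in> V1 then \<mu>1 i else 0) - (if i \<in> V0 then \<mu>0 i else 0)) = \<alpha> * ?\<tau>\<^sup>2"
    and \<alpha>: "alpha_star p ?\<tau> a \<Omega> V0 V1 \<le> \<alpha>" "\<alpha> \<le> alpha_star p ?\<tau> a \<Omega> V0 V1 + \<delta>"
    by (rule alpha_star_approx[OF \<Omega> \<tau> pos(3) Vs \<delta>(1)])
  \<comment> \<open>Scaled so that 2 A l is the inflated squared separation in noise units, by
    \<tau>^2 = 2 r \<sigma>^2 l.\<close>
  define A where "A = (1 + \<delta>) * (\<alpha> * r)"
  have \<alpha>r: "x \<le> \<alpha> * r" "\<alpha> * r \<le> x + \<delta> * r"
    using \<alpha> pos mult_right_mono[OF \<alpha>(1), of r] mult_right_mono[OF \<alpha>(2), of r]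
    by (auto simp: x_def algebra_simps)
  have A_ge: "x \<le> A" using \<alpha>r(1) x \<delta> mult_right_mono[of 1 "1 + \<delta>" "\<alpha> * r"] by (simp add: A_def)
  have A_le: "A \<le> x + \<delta> * (6 * M + 2 * r)"
  proof -
    have "A \<le> (1 + \<delta>) * (x + \<delta> * r)" unfolding A_def using \<alpha>r \<delta> by (intro mult_left_mono) auto
    also have "\<dots> = x + \<delta> * (x + (1 + \<delta>) * r)" by (simp add: algebra_simps)
    also have "\<dots> \<le> x + \<delta> * (6 * M + 2 * r)"
    proof -
      have "(1 + \<delta>) * r \<le> 2 * r" using \<delta> pos by (intro mult_right_mono) auto
      hence "x + (1 + \<delta>) * r \<le> 6 * M + 2 * r" using x_le by linarith
      hence "\<delta> * (x + (1 + \<delta>) * r) \<le> \<delta> * (6 * M + 2 * r)" using \<delta>(1) by (intro mult_left_mono) auto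
      thus ?thesis by linarith
    qed
    finally show ?thesis .
  qed
  \<comment> \<open>A bound free of \<delta>, by \<delta> \<le> 1; it fixes the constant in
    \<open>K\<close>.\<close>
  have A_le': "A \<le> 12 * M + 2 * r"
  proof -
    have "\<delta> * (6 * M + 2 * r) \<le> 1 * (6 * M + 2 * r)" using \<delta> M pos by (intro mult_right_mono) auto
    hence "x + \<delta> * (6 * M + 2 * r) \<le> 6 * M + (6 * M + 2 * r)" using x_le by (intro add_mono) auto
    thus ?thesis using order_trans[OF A_le] by simp
  qed
  define E where "E = max v0 v1 + h A / 4"
  obtain s where s: "0 \<le> s" "s \<le> 1" "v0 + s\<^sup>2 * A \<le> E" "v1 + (1 - s)\<^sup>2 * A \<le> E"
    using exponent_balance[OF order_trans[OF x A_ge], of v0 v1, folded h_def E_def] by blast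
  have "h A \<le> h x + (A - x)" unfolding h_def using x A_ge by (intro power2_max_sqrt_diff_Lipschitz) auto
  also have "\<dots> \<le> h x + \<delta> * (6 * M + 2 * r)" using A_le by simp
  finally have hA: "h A \<le> h x + \<delta> * (6 * M + 2 * r)" .
  have E_le: "E \<le> \<eta> + \<delta> * (6 * M + 2 * r)"
  proof -
    have "0 \<le> \<delta> * (6 * M + 2 * r)" using \<delta> M pos by (intro mult_nonneg_nonneg) auto
    moreover have "y / 4 \<le> z / 4 + T" if "y \<le> z + T" "0 \<le> T" for y z T :: real using that by simp
    ultimately show ?thesis unfolding E_def \<eta>_eq using hA by (simp add: add.assoc)
  qed
  define m where "m = exp (- E * l)"
  \<comment> \<open>Large enough for 2 V \<le> K^2 with V = 2 A l, yet only of order sqrt l, so that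
    exp (- K) is no smaller than p^(-\<delta>).\<close>
  define K where "K = 2 * sqrt ((12 * M + 2 * r) * l)"
  have K0: "0 < K" using M pos l by (simp add: K_def)
  have \<epsilon>_pow: "?\<epsilon> ^ k * exp (- t\<^sup>2 * (2 * A * l) / 2) = exp (- (real k * \<theta> + t\<^sup>2 * A) * l)" for k t
  proof -
    have "?\<epsilon> ^ k = exp (real k * (- \<theta> * l))" unfolding eps_of_def powr_l by (rule exp_of_nat_mult[symmetric])
    thus ?thesis by (simp add: exp_add[symmetric] algebra_simps)
  qed
  have "\<delta> / 4 * real p powr (- \<eta> - \<delta> * (6 * M + 2 * r + 1)) \<le> m * (exp (- K) / 2) * (\<delta> / (1 + \<delta>))"
  proof -
    have "(- \<eta> - \<delta> * (6 * M + 2 * r + 1)) * l = - (\<eta> + \<delta> * (6 * M + 2 * r)) * l - \<delta> * l"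
      by (simp add: algebra_simps)
    also have "\<dots> \<le> - E * l - K"
    proof -
      have "E * l \<le> (\<eta> + \<delta> * (6 * M + 2 * r)) * l" using E_le l by (intro mult_right_mono) auto
      moreover have "K \<le> \<delta> * l" using K by (simp add: K_def l_def)
      moreover have "- y * l - d \<le> - E * l - k" if "E * l \<le> y * l" "k \<le> d" for y d k
        using that by simp
      ultimately show ?thesis by blast
    qed
    finally have "real p powr (- \<eta> - \<delta> * (6 * M + 2 * r + 1)) \<le> m * exp (- K)"
      by (simp add: powr_l m_def exp_add[symmetric])
    moreover have "\<delta> / 4 \<le> \<delta> / (1 + \<delta>) / 2" using \<delta> by (simp add: field_simps)
    ultimately have "\<delta> / 4 * real p powr (- \<eta> - \<delta> * (6 * M + 2 * r + 1)) \<le>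
        \<delta> / (1 + \<delta>) / 2 * (m * exp (- K))"
      using \<delta> by (intro mult_mono) auto
    thus ?thesis by (simp add: mult_ac)
  qed
  also have "m * (exp (- K) / 2) * (\<delta> / (1 + \<delta>)) \<le>
      ?\<epsilon> ^ card V0 * sign_risk (n_of \<kappa> p) p \<sigma> \<Omega> est \<beta>0 i + ?\<epsilon> ^ card V1 * sign_risk (n_of \<kappa> p) p \<sigma> \<Omega> est \<beta>1 i"
    if est: "est \<in> estimators (n_of \<kappa> p) p"
      and \<beta>0: "\<forall>i\<in>V0 \<union> V1. \<beta>0 i = (if i \<in> V0 then \<mu>0 i else 0)"
      and \<beta>1: "\<forall>i\<in>V0 \<union> V1. \<beta>1 i = (if i \<in> V1 then \<mu>1 i else 0)"
      and eq: "\<forall>i. i \<notin> V0 \<union> V1 \<longrightarrow> \<beta>0 i = \<beta>1 i" for est \<beta>0 \<beta>1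
  proof (rule sign_risk_two_point[OF \<Omega> est _ _ _ _ _ pos(4) s(1,2) \<delta>(1) _ _ K0, where V = "2 * A * l"])
    have "0 < real p powr \<kappa>" using p by simp
    thus "0 < n_of \<kappa> p" unfolding n_of_def by linarith
    show "i < p" using i Vs by auto
    show "sgn (\<beta>0 i) \<noteq> sgn (\<beta>1 i)" using sgn i \<beta>0 \<beta>1 by auto
    \<comment> \<open>Off the supports the common coefficients cancel, so the separation is that of
      the chosen pair.\<close>
    have "(\<lambda>j. \<beta>1 j - \<beta>0 j) = (\<lambda>i. (if i \<in> V1 then \<mu>1 i else 0) - (if i \<in> V0 then \<mu>0 i else 0))"
    proof (rule ext)
      fix k show "\<beta>1 k - \<beta>0 k = (if k \<in> V1 then \<mu>1 k else 0) - (if k \<in> V0 then \<mu>0 k else 0)"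
        using \<beta>0 \<beta>1 eq by (cases "k \<in> V0 \<union> V1") auto
    qed
    thus "(1 + \<delta>) * (quad p \<Omega> (\<lambda>j. \<beta>1 j - \<beta>0 j) / \<sigma>\<^sup>2) \<le> 2 * A * l"
      using quad pos(4) by (simp add: \<tau>2 A_def)
    have "K\<^sup>2 = 4 * ((12 * M + 2 * r) * l)" using M pos l by (simp add: K_def power_mult_distrib)
    thus "2 * (2 * A * l) \<le> K\<^sup>2" using mult_right_mono[OF A_le', of l] l by simp
    have le: "- E * l \<le> - y * l" if "y \<le> E" for y using that l by simp
    show "m \<le> ?\<epsilon> ^ card V0 * exp (- s\<^sup>2 * (2 * A * l) / 2)"
      unfolding \<epsilon>_pow m_def using le[OF s(3)] by (simp add: v0_def)
    show "m \<le> ?\<epsilon> ^ card V1 * exp (- (1 - s)\<^sup>2 * (2 * A * l) / 2)"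
      unfolding \<epsilon>_pow m_def using le[OF s(4)] by (simp add: v1_def)
  qed (simp_all add: eps_of_def m_def)
  finally have final: "\<delta> / 4 * real p powr (- \<eta> - \<delta> * (6 * M + 2 * r + 1)) \<le>
      ?\<epsilon> ^ card V0 * sign_risk (n_of \<kappa> p) p \<sigma> \<Omega> est \<beta>0 i + ?\<epsilon> ^ card V1 * sign_risk (n_of \<kappa> p) p \<sigma> \<Omega> est \<beta>1 i"
    if "est \<in> estimators (n_of \<kappa> p) p"
      "\<forall>i\<in>V0 \<union> V1. \<beta>0 i = (if i \<in> V0 then \<mu>0 i else 0)"
      "\<forall>i\<in>V0 \<union> V1. \<beta>1 i = (if i \<in> V1 then \<mu>1 i else 0)"
      "\<forall>i. i \<notin> V0 \<union> V1 \<longrightarrow> \<beta>0 i = \<beta>1 i" for est \<beta>0 \<beta>1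
    using that by blast
  show ?thesis by (rule bexI[OF bexI[OF bexI[OF _ i] \<mu>(2)] \<mu>(1)]) (use final in blast)
qed

text \<open>The 16 in \<delta> / 16 collects the 4 of the two-point bound, a 2 from the equal prior
  on the pair and a 2 from d + 1 \<le> 2 max 1 d. The power of 1/2 bounds (1 - \<epsilon>)^(card D),
  as \<epsilon> \<le> 1/2.\<close>

lemma Hamm_star_ge_GOLF:
  fixes \<theta> r a \<sigma> \<delta> :: real
  defines "M \<equiv> (\<theta> + r)\<^sup>2 / (4 * r)"
  assumes \<Omega>: "corr_matrix p \<Omega>" and pos: "0 < \<theta>" "0 < r" "1 \<le> a" "0 < \<sigma>" and \<delta>: "0 < \<delta>" "\<delta> \<le> 1"
    and p: "2 \<le> p" and K: "2 * sqrt ((12 * M + 2 * r) * ln (real p)) \<le> \<delta> * ln (real p)"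
    and \<epsilon>: "eps_of \<theta> p \<le> 1 / 2"
  shows "(1 / 2) ^ nat \<lceil>2 * M / \<theta>\<rceil> * (\<delta> / 16) * real p powr (- (\<delta> * (6 * M + 2 * r + 1))) *
      (1 / real (max 1 (golf_degree \<sigma> \<theta> r a p \<Omega>)) *
       (\<Sum>j<p. real p powr (- rho_star \<sigma> \<theta> r a p \<Omega> j))) \<le> Hamm_star \<sigma> \<theta> \<kappa> r a p \<Omega>"
proof -
  let ?\<tau> = "tau_of \<sigma> r p" and ?\<epsilon> = "eps_of \<theta> p"
  define d where "d = golf_degree \<sigma> \<theta> r a p \<Omega>"
  define \<rho> where "\<rho> j = rho_star \<sigma> \<theta> r a p \<Omega> j" for j
  define w where "w j = real p powr (- \<rho> j)" for j
  define D where "D j = golf_support \<sigma> \<theta> r a p \<Omega> j" for j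
  define V0 where "V0 j = fst (golf_pair \<sigma> \<theta> r a p \<Omega> j)" for j
  define V1 where "V1 j = snd (golf_pair \<sigma> \<theta> r a p \<Omega> j)" for j
  have D_eq: "D j = V0 j \<union> V1 j" for j by (simp add: D_def V0_def V1_def golf_support_def)
  have \<tau>: "0 < ?\<tau>" using p pos by (simp add: tau_of_def)
  have pair: "(V0 j, V1 j) \<in> pairs_for p j"
    and eta: "eta p \<theta> r ?\<tau> a \<Omega> (V0 j) (V1 j) = \<rho> j" if "j < p" for j
    using golf_pair_minimizer[OF that, of \<sigma> \<theta> r a \<Omega> "V0 j" "V1 j"]
    by (simp_all add: V0_def V1_def \<rho>_def)
  have \<rho>M: "\<rho> j \<le> M" if "j < p" for j
    unfolding \<rho>_def M_def by (rule rho_star_le[OF \<Omega> \<tau> pos(3) that pos(1,2)])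
  have "\<exists>I\<subseteq>{..<p}. (\<forall>j\<in>I. \<forall>k\<in>I. j \<noteq> k \<longrightarrow> \<not> D j \<inter> D k \<noteq> {}) \<and> sum w {..<p} \<le> real (d + 1) * sum w I"
  proof (rule weighted_independent_set)
    show "symp (\<lambda>j k. D j \<inter> D k \<noteq> {})" by (auto intro!: sympI)
    fix j assume "j \<in> {..<p}"
    hence "card {k. k < p \<and> k \<noteq> j \<and> D j \<inter> D k \<noteq> {}} \<le> d"
      unfolding d_def golf_degree_def D_def by (intro Max_ge) auto
    thus "card {k \<in> {..<p}. k \<noteq> j \<and> D j \<inter> D k \<noteq> {}} \<le> d" by simp
  qed (simp_all add: w_def)
  then obtain I where I: "I \<subseteq> {..<p}" "\<And>j k. j \<in> I \<Longrightarrow> k \<in> I \<Longrightarrow> j \<noteq> k \<Longrightarrow> D j \<inter> D k = {}"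
    and sumI: "sum w {..<p} \<le> real (d + 1) * sum w I" by auto
  have finI: "finite I" using I(1) finite_subset by blast
  define c where "c j = \<delta> / 4 * real p powr (- \<rho> j - \<delta> * (6 * M + 2 * r + 1))" for j
  \<comment> \<open>The witnesses of a block form one triple, so that a single choice provides them
    for all \<open>j\<close>, uniformly over estimators.\<close>
  define good where "good j t \<longleftrightarrow> (case t of (\<mu>0, \<mu>1, i) \<Rightarrow>
      \<mu>0 \<in> Theta p ?\<tau> a \<and> \<mu>1 \<in> Theta p ?\<tau> a \<and> i \<in> D j \<and>
      (\<forall>est\<in>estimators (n_of \<kappa> p) p. \<forall>\<beta>0 \<beta>1.
      (\<forall>i\<in>D j. \<beta>0 i = (if i \<in> V0 j then \<mu>0 i else 0)) \<longrightarrow>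
      (\<forall>i\<in>D j. \<beta>1 i = (if i \<in> V1 j then \<mu>1 i else 0)) \<longrightarrow>
      (\<forall>i. i \<notin> D j \<longrightarrow> \<beta>0 i = \<beta>1 i) \<longrightarrow>
      c j \<le> ?\<epsilon> ^ card (V0 j) * sign_risk (n_of \<kappa> p) p \<sigma> \<Omega> est \<beta>0 i +
        ?\<epsilon> ^ card (V1 j) * sign_risk (n_of \<kappa> p) p \<sigma> \<Omega> est \<beta>1 i))" for j t
  have "\<exists>t. good j t" if "j \<in> I" for j
  proof -
    have j: "j < p" using that I(1) by auto
    have "eta p \<theta> r ?\<tau> a \<Omega> (V0 j) (V1 j) \<le> (\<theta> + r)\<^sup>2 / (4 * r)"
      using eta[OF j] \<rho>M[OF j] by (simp add: M_def)
    from least_favorable_pair_two_point[OF \<Omega> pos \<delta> p pair[OF j] this K[unfolded M_def], where \<kappa> = \<kappa>]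
    show ?thesis unfolding good_def c_def D_eq split_paired_Ex prod.case eta[OF j] M_def[symmetric] by blast
  qed
  then obtain t where t: "\<And>j. j \<in> I \<Longrightarrow> good j (t j)" by metis
  define \<mu>0 where "\<mu>0 j = fst (t j)" for j
  define \<mu>1 where "\<mu>1 j = fst (snd (t j))" for j
  define x where "x j = snd (snd (t j))" for j
  have t_eq: "t j = (\<mu>0 j, \<mu>1 j, x j)" for j by (simp add: \<mu>0_def \<mu>1_def x_def)
  note good = t[unfolded t_eq good_def prod.case]
  have D_sub: "D j \<subseteq> {..<p}" if "j \<in> I" for j
    using pair[of j] I(1) that by (auto simp: D_eq pairs_for_def)
  have Hamm_ge: "(\<Sum>j\<in>I. (1 - ?\<epsilon>) ^ card (D j) * c j / 2) \<le> Hamm_star \<sigma> \<theta> \<kappa> r a p \<Omega>"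
  proof (rule Hamm_star_ge_sum_blocks[where ?V0.0 = V0 and ?V1.0 = V1 and x = x and ?\<mu>0.0 = \<mu>0 and ?\<mu>1.0 = \<mu>1])
    show "D j \<subseteq> {..<p} \<and> V0 j \<subseteq> D j \<and> V1 j \<subseteq> D j \<and> x j \<in> D j" if "j \<in> I" for j
      using good[OF that] D_sub[OF that] by (auto simp: D_eq)
    show "\<mu>0 j \<in> Theta p ?\<tau> a \<and> \<mu>1 j \<in> Theta p ?\<tau> a" if "j \<in> I" for j
      using good[OF that] by blast
    show "c j \<le> ?\<epsilon> ^ card (V0 j) * sign_risk (n_of \<kappa> p) p \<sigma> \<Omega> est \<beta>0 (x j) +
        ?\<epsilon> ^ card (V1 j) * sign_risk (n_of \<kappa> p) p \<sigma> \<Omega> est \<beta>1 (x j)"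
      if "j \<in> I" "est \<in> estimators (n_of \<kappa> p) p"
        "\<And>i. i \<in> D j \<Longrightarrow> \<beta>0 i = (if i \<in> V0 j then \<mu>0 j i else 0)"
        "\<And>i. i \<in> D j \<Longrightarrow> \<beta>1 i = (if i \<in> V1 j then \<mu>1 j i else 0)"
        "\<And>i. i \<notin> D j \<Longrightarrow> \<beta>0 i = \<beta>1 i" for j est \<beta>0 \<beta>1
      using good[OF that(1), THEN conjunct2, THEN conjunct2, THEN conjunct2, THEN bspec, OF that(2), THEN spec, THEN spec,
          of \<beta>0 \<beta>1] that(3-5) by simp
  qed (use pos p \<tau> finI I(2) in simp_all)
  have sum_ge: "(1 / 2) ^ nat \<lceil>2 * M / \<theta>\<rceil> * (\<delta> / 8) * real p powr (- (\<delta> * (6 * M + 2 * r + 1))) * sum w I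
      \<le> (\<Sum>j\<in>I. (1 - ?\<epsilon>) ^ card (D j) * c j / 2)"
    unfolding sum_distrib_left
  proof (rule sum_mono)
    fix j assume j: "j \<in> I"
    hence jp: "j < p" using I(1) by auto
    \<comment> \<open>Each element of the larger support costs \<theta> in \<open>eta\<close>, so
      \<rho> \<le> M leaves at most M / \<theta> of them. The resulting 2 M / \<theta> equals
      (\<theta> + r)^2 / (2 \<theta> r), the threshold that occurs in \<open>g_of\<close>.\<close>
    have "0 \<le> (max 0 (sqrt y - z / sqrt y))\<^sup>2" for y z :: real by simp
    hence "real (max (card (V0 j)) (card (V1 j))) * \<theta> \<le> \<rho> j"
      unfolding eta[OF jp, symmetric] by (simp add: eta_def Let_def)
    hence "real (max (card (V0 j)) (card (V1 j))) * \<theta> \<le> M" using \<rho>M[OF jp] by linarith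
    hence "real (max (card (V0 j)) (card (V1 j))) \<le> M / \<theta>" using pos by (simp add: le_divide_eq)
    moreover have "card (D j) \<le> card (V0 j) + card (V1 j)" unfolding D_eq by (rule card_Un_le)
    ultimately have "real (card (D j)) \<le> 2 * M / \<theta>" by simp
    hence "card (D j) \<le> nat \<lceil>2 * M / \<theta>\<rceil>" by linarith
    hence "(1 / 2 :: real) ^ nat \<lceil>2 * M / \<theta>\<rceil> \<le> (1 / 2) ^ card (D j)" by (intro power_decreasing) auto
    also have "\<dots> \<le> (1 - ?\<epsilon>) ^ card (D j)" using \<epsilon> by (intro power_mono) auto
    finally have le: "(1 / 2) ^ nat \<lceil>2 * M / \<theta>\<rceil> * (c j / 2) \<le> (1 - ?\<epsilon>) ^ card (D j) * (c j / 2)"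
      using \<delta> by (intro mult_right_mono) (simp_all add: c_def)
    have cj: "c j / 2 = \<delta> / 8 * (real p powr (- (\<delta> * (6 * M + 2 * r + 1))) * w j)"
      unfolding c_def w_def powr_add[symmetric] by (simp add: add.commute)
    have "(1 / 2) ^ nat \<lceil>2 * M / \<theta>\<rceil> * (\<delta> / 8) * real p powr (- (\<delta> * (6 * M + 2 * r + 1))) * w j
        = (1 / 2) ^ nat \<lceil>2 * M / \<theta>\<rceil> * (c j / 2)"
      unfolding cj by (simp only: mult.assoc)
    also have "\<dots> \<le> (1 - ?\<epsilon>) ^ card (D j) * c j / 2" using le by simp
    finally show "(1 / 2) ^ nat \<lceil>2 * M / \<theta>\<rceil> * (\<delta> / 8) * real p powr (- (\<delta> * (6 * M + 2 * r + 1))) * w j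
        \<le> (1 - ?\<epsilon>) ^ card (D j) * c j / 2" .
  qed
  have "(1 / 2) ^ nat \<lceil>2 * M / \<theta>\<rceil> * (\<delta> / 16) * real p powr (- (\<delta> * (6 * M + 2 * r + 1))) *
      (1 / real (max 1 d) * sum w {..<p}) \<le>
      (1 / 2) ^ nat \<lceil>2 * M / \<theta>\<rceil> * (\<delta> / 16) * real p powr (- (\<delta> * (6 * M + 2 * r + 1))) * (2 * sum w I)"
  proof (rule mult_left_mono)
    \<comment> \<open>The factor 2 max 1 d also covers an edgeless graph, where d = 0.\<close>
    have "sum w {..<p} \<le> real (d + 1) * sum w I" by (rule sumI)
    also have "\<dots> \<le> (2 * real (max 1 d)) * sum w I"
      by (intro mult_right_mono sum_nonneg) (auto simp: w_def)
    finally show "1 / real (max 1 d) * sum w {..<p} \<le> 2 * sum w I" by (simp add: field_simps)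
  qed (use \<delta> in auto)
  also have "\<dots> = (1 / 2) ^ nat \<lceil>2 * M / \<theta>\<rceil> * (\<delta> / 8) *
      real p powr (- (\<delta> * (6 * M + 2 * r + 1))) * sum w I" by simp
  also note sum_ge
  also note Hamm_ge
  finally show ?thesis unfolding d_def w_def \<rho>_def .
qed

text \<open>The constants C depend on \<delta> whereas L must not. Taking L to be the quotient H / R
  itself makes one function serve all \<delta> at once.\<close>

lemma multi_log_factor:
  fixes H R :: "nat \<Rightarrow> real"
  assumes lower: "\<And>\<delta>. 0 < \<delta> \<Longrightarrow> \<exists>C>0. \<forall>\<^sub>F p in sequentially. C * real p powr (- \<delta>) * R p \<le> H p"
    and R: "\<forall>\<^sub>F p in sequentially. 0 < R p"
  shows "\<exists>L. multi_log L \<and> (\<forall>\<^sub>F p in sequentially. L p * R p \<le> H p)"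
proof -
  define q where "q p = H p / R p" for p
  \<comment> \<open>The cap at 1 yields L p^(-\<delta>) \<rightarrow> 0 directly, and the default 1
    keeps L positive at the finitely many p where the quotient may fail to be.\<close>
  define L where "L p = (if 0 < q p then min 1 (q p) else 1)" for p
  have q_lower: "\<exists>C>0. \<forall>\<^sub>F p in sequentially. 0 < q p \<and> C * real p powr (- \<delta>) \<le> q p" if \<delta>: "0 < \<delta>" for \<delta>
  proof -
    from lower[OF \<delta>] obtain C where C: "0 < C" "\<forall>\<^sub>F p in sequentially. C * real p powr (- \<delta>) * R p \<le> H p" by blast
    have "\<forall>\<^sub>F p in sequentially. 0 < q p \<and> C * real p powr (- \<delta>) \<le> q p"
      using C(2) R eventually_gt_at_top[of 0]
    proof eventually_elim
      case (elim p)
      hence "C * real p powr (- \<delta>) \<le> q p" by (simp add: q_def le_divide_eq)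
      moreover have "0 < C * real p powr (- \<delta>)" using C(1) elim by simp
      ultimately show ?case by linarith
    qed
    thus ?thesis using C(1) by blast
  qed
  have Lpos: "0 < L p" and L1: "L p \<le> 1" for p by (auto simp: L_def)
  have "filterlim (\<lambda>p. L p * real p powr \<delta>) at_top sequentially" if \<delta>: "0 < \<delta>" for \<delta>
  proof -
    \<comment> \<open>Half of \<delta> is spent on the lower bound, so the other half still drives L
      p^\<delta> to infinity.\<close>
    obtain C where C: "0 < C" "\<forall>\<^sub>F p in sequentially. 0 < q p \<and> C * real p powr (- (\<delta> / 2)) \<le> q p"
      using q_lower[of "\<delta> / 2"] \<delta> by auto
    define c where "c = min 1 C"
    have c: "0 < c" "c \<le> 1" "c \<le> C" using C(1) by (auto simp: c_def)
    have "filterlim (\<lambda>p. c * real p powr (\<delta> / 2)) at_top sequentially"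
      using c(1) \<delta> by real_asymp
    moreover have "\<forall>\<^sub>F p in sequentially. c * real p powr (\<delta> / 2) \<le> L p * real p powr \<delta>"
      using C(2) eventually_ge_at_top[of 1]
    proof eventually_elim
      case (elim p)
      have le1: "real p powr (- (\<delta> / 2)) \<le> 1"
        using elim(2) \<delta> powr_mono[of "- (\<delta> / 2)" 0 "real p"] by simp
      have "c * real p powr (- (\<delta> / 2)) \<le> 1 * 1" using c le1 by (intro mult_mono) auto
      moreover have "c * real p powr (- (\<delta> / 2)) \<le> C * real p powr (- (\<delta> / 2))"
        using c by (intro mult_right_mono) auto
      ultimately have "c * real p powr (- (\<delta> / 2)) \<le> L p" using elim(1) by (auto simp: L_def)
      hence "c * real p powr (- (\<delta> / 2)) * real p powr \<delta> \<le> L p * real p powr \<delta>"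
        by (intro mult_right_mono) auto
      moreover have "real p powr (- (\<delta> / 2)) * real p powr \<delta> = real p powr (\<delta> / 2)"
        by (simp add: powr_add[symmetric])
      ultimately show ?case by (simp add: mult.assoc)
    qed
    ultimately show ?thesis by (rule filterlim_at_top_mono)
  qed
  moreover have "(\<lambda>p. L p * real p powr (- \<delta>)) \<longlonglongrightarrow> 0" if \<delta>: "0 < \<delta>" for \<delta>
  proof (rule tendsto_sandwich[where f = "\<lambda>_. 0" and h = "\<lambda>p. real p powr (- \<delta>)"])
    show "(\<lambda>p. real p powr (- \<delta>)) \<longlonglongrightarrow> 0" using \<delta> by real_asymp
    show "\<forall>\<^sub>F p in sequentially. L p * real p powr (- \<delta>) \<le> real p powr (- \<delta>)"
      using mult_right_mono[OF L1] by (intro always_eventually allI) fastforce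
  qed (use Lpos in \<open>auto intro!: always_eventually simp: less_imp_le\<close>)
  ultimately have "multi_log L" using Lpos unfolding multi_log_def by blast
  moreover have "\<forall>\<^sub>F p in sequentially. L p * R p \<le> H p"
  proof -
    from q_lower[of 1] have "\<forall>\<^sub>F p in sequentially. 0 < q p" by (auto elim: eventually_mono)
    with R show ?thesis
    proof eventually_elim
      case (elim p)
      hence "L p \<le> q p" by (simp add: L_def)
      hence "L p * R p \<le> q p * R p" using elim by (intro mult_right_mono) auto
      thus ?case using elim by (simp add: q_def)
    qed
  qed
  ultimately show ?thesis by blast
qed

theorem theorem6:
  fixes \<theta> \<kappa> r a \<sigma> c0 :: real and m0 :: nat
    and \<Omega> :: "nat \<Rightarrow> nat \<Rightarrow> nat \<Rightarrow> real"
  assumes "0 < \<theta>" "\<theta> < 1" "0 < \<kappa>" "\<kappa> < 1" "0 < r" "1 \<le> a" "\<kappa> > 1 - \<theta>"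
    and "1 \<le> m0" "0 < c0" "0 < \<sigma>"
    and "\<forall>p. corr_matrix p (\<Omega> p)"
    and "eventually (\<lambda>p. in_M p c0 (g_of m0 \<theta> r) (\<Omega> p)) sequentially"
  shows "\<exists>L. multi_log L \<and>
           eventually (\<lambda>p. Hamm_star \<sigma> \<theta> \<kappa> r a p (\<Omega> p) \<ge>
              L p * (1 / real (max 1 (golf_degree \<sigma> \<theta> r a p (\<Omega> p)))) *
              (\<Sum>j<p. real p powr (- rho_star \<sigma> \<theta> r a p (\<Omega> p) j))) sequentially"
proof -
  define M where "M = (\<theta> + r)\<^sup>2 / (4 * r)"
  define R where "R p = 1 / real (max 1 (golf_degree \<sigma> \<theta> r a p (\<Omega> p))) *
      (\<Sum>j<p. real p powr (- rho_star \<sigma> \<theta> r a p (\<Omega> p) j))" for p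
  have M: "0 < M" using assms by (simp add: M_def)
  have "\<exists>L. multi_log L \<and> (\<forall>\<^sub>F p in sequentially. L p * R p \<le> Hamm_star \<sigma> \<theta> \<kappa> r a p (\<Omega> p))"
  proof (rule multi_log_factor)
    fix \<delta> :: real assume \<delta>: "0 < \<delta>"
    define B where "B = 6 * M + 2 * r + 1"
    \<comment> \<open>The internal accuracy, scaled so that the total loss d B in the exponent stays
      within \<delta>.\<close>
    define d where "d = min 1 (\<delta> / B)"
    have B: "0 < B" using M assms by (simp add: B_def)
    have d: "0 < d" "d \<le> 1" "d * B \<le> \<delta>"
      using \<delta> B by (auto simp: d_def min_def field_simps)
    define C where "C = (1 / 2) ^ nat \<lceil>2 * M / \<theta>\<rceil> * (d / 16)"
    have C: "0 < C" using d by (simp add: C_def)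
    define A where "A = 12 * M + 2 * r"
    have A: "0 < A" using M assms by (simp add: A_def)
    \<comment> \<open>Holds for large p because sqrt (log p) is of smaller order than log p.\<close>
    have K: "\<forall>\<^sub>F p in sequentially. 2 * sqrt (A * ln (real p)) \<le> d * ln (real p)"
      using A d(1) by real_asymp
    have "(\<lambda>p. eps_of \<theta> p) \<longlonglongrightarrow> 0" unfolding eps_of_def using assms(1) by real_asymp
    hence \<epsilon>: "\<forall>\<^sub>F p in sequentially. eps_of \<theta> p < 1 / 2" by (rule order_tendstoD) simp
    have "\<forall>\<^sub>F p in sequentially. C * real p powr (- \<delta>) * R p \<le> Hamm_star \<sigma> \<theta> \<kappa> r a p (\<Omega> p)"
      using K \<epsilon> eventually_ge_at_top[of 2]
    proof eventually_elim
      case (elim p)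
      have "C * real p powr (- \<delta>) * R p \<le> C * real p powr (- (d * B)) * R p"
        using C d(3) elim(3) by (intro mult_right_mono mult_left_mono powr_mono)
          (auto simp: R_def intro!: divide_nonneg_nonneg sum_nonneg)
      also have "\<dots> \<le> Hamm_star \<sigma> \<theta> \<kappa> r a p (\<Omega> p)"
        unfolding C_def B_def R_def M_def
        using elim assms d unfolding A_def M_def by (intro Hamm_star_ge_GOLF) auto
      finally show ?case .
    qed
    thus "\<exists>C>0. \<forall>\<^sub>F p in sequentially. C * real p powr (- \<delta>) * R p \<le> Hamm_star \<sigma> \<theta> \<kappa> r a p (\<Omega> p)"
      using C by blast
  next
    show "\<forall>\<^sub>F p in sequentially. 0 < R p"
      using eventually_gt_at_top[of 0]
    proof eventually_elim
      case (elim p)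
      have "0 < (\<Sum>j<p. real p powr (- rho_star \<sigma> \<theta> r a p (\<Omega> p) j))"
        using elim by (intro sum_pos) auto
      thus ?case by (simp add: R_def)
    qed
  qed
  thus ?thesis by (simp add: R_def mult.assoc)
qed

end
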